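(* Let $\mathcal X$ and $\mathcal Y$ be infinite dimensional complex Banach spaces and let $A\in L(\mathcal X)$ and $B\in L(\mathcal Y)$ be such that $A$ and $B^*$ are $a$-isoloid and generalized $a$-Weyl's theorem holds for $A$ and for $B^*$. Let $\rho\colon L(\mathcal Y,\mathcal X)\to L(\mathcal Y,\mathcal X)$ be the generalized derivation defined by $A$ and $B$, i.e. $\rho(U)=AU-UB$ for $U\in L(\mathcal Y,\mathcal X)$. Then the following statements are equivalent. (i) Generalized $a$-Weyl's theorem holds for $\rho\in L(L(\mathcal Y,\mathcal X))$. (ii) Generalized $a$-Browder's theorem holds for $\rho\in L(L(\mathcal Y,\mathcal X))$ and $$\sigma_{SBF_+^-}(\rho)=(\sigma_a(A)-\sigma_{SBF_+^-}(B^* ))\cup(\sigma_{SBF_+^-}(A)-\sigma_a(B^* )).$$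
   Context: $L(\mathcal Y,\mathcal X)$ is the Banach space of bounded linear maps from $\mathcal Y$ to $\mathcal X$, $L(\mathcal X)=L(\mathcal X,\mathcal X)$, and $B^*\in L(\mathcal Y^* )$ is the (Banach space) adjoint of $B$. For $S,T\subseteq\mathbb C$, $S-T=\{s-t: s\in S,\ t\in T\}$ (empty if $S$ or $T$ is empty). For $K\subseteq\mathbb C$, $\mathrm{iso}\,K$ is the set of isolated points of $K$. For a bounded operator $T$ on a Banach space, $N(T)$ and $R(T)$ are its null space and range, $\alpha(T)=\dim N(T)$, $\beta(T)$ is the codimension of $R(T)$, $\mathrm{ind}(T)=\alpha(T)-\beta(T)$. $T$ is bounded below if $N(T)=0$ and $R(T)$ is closed; $T$ is upper semi-Fredholm if $R(T)$ is closed and $\alpha(T)<\infty$ (its index may be $-\infty$). $T$ is upper semi B-Fredholm if there is $n\in\mathbb N$ such that $R(T^n)$ is closed and the induced operator $T_n=T|_{R(T^n)}\in L(R(T^n))$ is upper semi-Fredholm; its index is $\mathrm{ind}(T)=\mathrm{ind}(T_n)$, independent of such $n$. $\sigma_a(T)=\{\lambda\in\mathbb C: T-\lambda$ is not bounded below$\}$; $\sigma_{SBF_+^-}(T)=\{\lambda\in\mathbb C: T-\lambda$ is not upper semi B-Fredholm or $0<\mathrm{ind}(T-\lambda)\}$. The ascent $\mathrm{asc}(T)$ is the smallest integer $a\ge0$ with $N(T^a)=N(T^{a+1})$ ($\infty$ if none exists). $\Pi^a(T)=\{\lambda\in\mathrm{iso}\,\sigma_a(T): a=\mathrm{asc}(T-\lambda)<\infty$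 and $R((T-\lambda)^{a+1})$ is closed$\}$ and $E^a(T)=\{\lambda\in\mathrm{iso}\,\sigma_a(T):0<\alpha(T-\lambda)\}$. $T$ is $a$-isoloid if $\mathrm{iso}\,\sigma_a(T)=E^a(T)$. Generalized $a$-Browder's theorem holds for $T$ if $\sigma_{SBF_+^-}(T)=\sigma_a(T)\setminus\Pi^a(T)$; generalized $a$-Weyl's theorem holds for $T$ if $\sigma_{SBF_+^-}(T)=\sigma_a(T)\setminus E^a(T)$. *)

theory Defs
  imports "HOL-Complex_Analysis.Complex_Analysis"
begin

section \<open>Complex normed and Banach spaces\<close>

text \<open>Complex scalars are added on top of the real structure provided by the library; the real
  scalar multiplication is the restriction of the complex one.\<close>

class complex_normed_vector = real_normed_vector +
  fixes scaleC :: "complex \<Rightarrow> 'a \<Rightarrow> 'a"  (infixr \<open>*\<^sub>C\<close> 75)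
  assumes scaleC_add_right: "c *\<^sub>C (x + y) = c *\<^sub>C x + c *\<^sub>C y"
    and scaleC_add_left: "(c + d) *\<^sub>C x = c *\<^sub>C x + d *\<^sub>C x"
    and scaleC_scaleC: "c *\<^sub>C (d *\<^sub>C x) = (c * d) *\<^sub>C x"
    and scaleR_scaleC: "r *\<^sub>R x = complex_of_real r *\<^sub>C x"
    and norm_scaleC: "norm (c *\<^sub>C x) = cmod c * norm x"

class cbanach = complex_normed_vector + banach

instantiation complex :: complex_normed_vector
begin
definition scaleC_complex :: "complex \<Rightarrow> complex \<Rightarrow> complex"
  where "scaleC_complex = (*)"
instance
  by standard (auto simp: scaleC_complex_def algebra_simps norm_mult scaleR_conv_of_real)
end

instance complex :: cbanach ..

lemma scaleC_one: "1 *\<^sub>C x = (x :: 'a :: complex_normed_vector)"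
  using scaleR_scaleC[of 1 x] by simp

global_interpretation complex_vector: vector_space
  "scaleC :: complex \<Rightarrow> 'a \<Rightarrow> 'a :: complex_normed_vector"
  by standard (simp_all add: scaleC_add_right scaleC_add_left scaleC_scaleC scaleC_one)

lemma bounded_linear_scaleC_right:
  "bounded_linear (\<lambda>x :: 'a :: complex_normed_vector. c *\<^sub>C x)"
  by (rule bounded_linear_intro[where K = "cmod c"])
    (auto simp: scaleC_add_right scaleR_scaleC scaleC_scaleC mult.commute norm_scaleC)

section \<open>Bounded complex-linear maps\<close>

definition bounded_clinear ::
    "('a :: complex_normed_vector \<Rightarrow> 'b :: complex_normed_vector) \<Rightarrow> bool"
  where "bounded_clinear f \<longleftrightarrow> bounded_linear f \<and> (\<forall>c x. f (c *\<^sub>C x) = c *\<^sub>C f x)"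

typedef (overloaded) ('a, 'b) cblinfun (\<open>(_ \<Rightarrow>\<^sub>\<complex> /_)\<close> [22, 21] 21) =
  "{f :: 'a :: complex_normed_vector \<Rightarrow> 'b :: complex_normed_vector. bounded_clinear f}"
  morphisms cblinfun_apply CBlinfun
  by (auto intro!: exI[of _ "\<lambda>_. 0"] simp: bounded_clinear_def)

setup_lifting type_definition_cblinfun

lemma bounded_clinear_cblinfun_apply: "bounded_clinear (cblinfun_apply T)"
  using cblinfun_apply[of T] by simp

lemma bounded_linear_cblinfun_apply: "bounded_linear (cblinfun_apply T)"
  using bounded_clinear_cblinfun_apply[of T] by (simp add: bounded_clinear_def)

lemma cblinfun_apply_scaleC: "cblinfun_apply T (c *\<^sub>C x) = c *\<^sub>C cblinfun_apply T x"
  using bounded_clinear_cblinfun_apply[of T] by (simp add: bounded_clinear_def)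

lemma cblinfun_apply_CBlinfun: "bounded_clinear f \<Longrightarrow> cblinfun_apply (CBlinfun f) = f"
  by (simp add: CBlinfun_inverse)

lemma cblinfun_eqI: "(\<And>x. cblinfun_apply S x = cblinfun_apply T x) \<Longrightarrow> S = T"
  by transfer auto

instantiation cblinfun :: (complex_normed_vector, complex_normed_vector) complex_normed_vector
begin

lift_definition norm_cblinfun :: "'a \<Rightarrow>\<^sub>\<complex> 'b \<Rightarrow> real" is onorm .

lift_definition zero_cblinfun :: "'a \<Rightarrow>\<^sub>\<complex> 'b" is "\<lambda>_. 0"
  by (simp add: bounded_clinear_def)

lift_definition plus_cblinfun :: "'a \<Rightarrow>\<^sub>\<complex> 'b \<Rightarrow> 'a \<Rightarrow>\<^sub>\<complex> 'b \<Rightarrow> 'a \<Rightarrow>\<^sub>\<complex> 'b" is "\<lambda>f g x. f x + g x"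
  by (auto simp: bounded_clinear_def scaleC_add_right intro: bounded_linear_add)

lift_definition minus_cblinfun :: "'a \<Rightarrow>\<^sub>\<complex> 'b \<Rightarrow> 'a \<Rightarrow>\<^sub>\<complex> 'b \<Rightarrow> 'a \<Rightarrow>\<^sub>\<complex> 'b" is "\<lambda>f g x. f x - g x"
  by (auto simp: bounded_clinear_def complex_vector.scale_right_diff_distrib
      intro: bounded_linear_sub)

lift_definition uminus_cblinfun :: "'a \<Rightarrow>\<^sub>\<complex> 'b \<Rightarrow> 'a \<Rightarrow>\<^sub>\<complex> 'b" is "\<lambda>f x. - f x"
  by (auto simp: bounded_clinear_def intro: bounded_linear_minus)

lift_definition scaleC_cblinfun :: "complex \<Rightarrow> 'a \<Rightarrow>\<^sub>\<complex> 'b \<Rightarrow> 'a \<Rightarrow>\<^sub>\<complex> 'b" is "\<lambda>c f x. c *\<^sub>C f x"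
  by (auto simp: bounded_clinear_def scaleC_scaleC mult.commute
      intro: bounded_linear_compose[OF bounded_linear_scaleC_right])

definition scaleR_cblinfun :: "real \<Rightarrow> 'a \<Rightarrow>\<^sub>\<complex> 'b \<Rightarrow> 'a \<Rightarrow>\<^sub>\<complex> 'b"
  where "scaleR_cblinfun r T = complex_of_real r *\<^sub>C T"

definition sgn_cblinfun :: "'a \<Rightarrow>\<^sub>\<complex> 'b \<Rightarrow> 'a \<Rightarrow>\<^sub>\<complex> 'b"
  where "sgn_cblinfun T = inverse (norm T) *\<^sub>R T"

definition dist_cblinfun :: "'a \<Rightarrow>\<^sub>\<complex> 'b \<Rightarrow> 'a \<Rightarrow>\<^sub>\<complex> 'b \<Rightarrow> real"
  where "dist_cblinfun S T = norm (S - T)"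

definition uniformity_cblinfun :: "(('a \<Rightarrow>\<^sub>\<complex> 'b) \<times> ('a \<Rightarrow>\<^sub>\<complex> 'b)) filter"
  where "uniformity_cblinfun = (INF e\<in>{0 <..}. principal {(x, y). dist x y < e})"

definition open_cblinfun :: "('a \<Rightarrow>\<^sub>\<complex> 'b) set \<Rightarrow> bool"
  where "open_cblinfun S = (\<forall>x\<in>S. \<forall>\<^sub>F (x', y) in uniformity. x' = x \<longrightarrow> y \<in> S)"

instance
proof
  fix S T U :: "'a \<Rightarrow>\<^sub>\<complex> 'b" and a b :: real and c d :: complex
  show "S + T + U = S + (T + U)" "S + T = T + S" "0 + S = S" "- S + S = 0" "S - T = S + - T"
    by (transfer; simp add: algebra_simps)+
  have C: "c *\<^sub>C (S + T) = c *\<^sub>C S + c *\<^sub>C T" "(c + d) *\<^sub>C S = c *\<^sub>C S + d *\<^sub>C S"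
    "c *\<^sub>C (d *\<^sub>C S) = (c * d) *\<^sub>C S" for c d and S T :: "'a \<Rightarrow>\<^sub>\<complex> 'b"
    by (transfer; simp add: scaleC_add_right scaleC_add_left scaleC_scaleC)+
  then show "c *\<^sub>C (S + T) = c *\<^sub>C S + c *\<^sub>C T" "(c + d) *\<^sub>C S = c *\<^sub>C S + d *\<^sub>C S"
    "c *\<^sub>C (d *\<^sub>C S) = (c * d) *\<^sub>C S"
    by blast+
  have R: "a *\<^sub>R S = complex_of_real a *\<^sub>C S" for a and S :: "'a \<Rightarrow>\<^sub>\<complex> 'b"
    by (rule scaleR_cblinfun_def)
  then show "a *\<^sub>R S = complex_of_real a *\<^sub>C S" .
  show "a *\<^sub>R (S + T) = a *\<^sub>R S + a *\<^sub>R T" "(a + b) *\<^sub>R S = a *\<^sub>R S + b *\<^sub>R S"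
    "a *\<^sub>R b *\<^sub>R S = (a * b) *\<^sub>R S"
    by (simp_all add: R C)
  show "1 *\<^sub>R S = S"
    unfolding R by transfer (simp add: scaleC_one)
  show "dist S T = norm (S - T)" by (rule dist_cblinfun_def)
  show "sgn S = inverse (norm S) *\<^sub>R S" by (rule sgn_cblinfun_def)
  show "(uniformity :: (('a \<Rightarrow>\<^sub>\<complex> 'b) \<times> ('a \<Rightarrow>\<^sub>\<complex> 'b)) filter) =
      (INF e\<in>{0 <..}. principal {(x, y). dist x y < e})"
    by (rule uniformity_cblinfun_def)
  show "open X = (\<forall>x\<in>X. \<forall>\<^sub>F (x', y) in uniformity. x' = x \<longrightarrow> y \<in> X)"
    for X :: "('a \<Rightarrow>\<^sub>\<complex> 'b) set"
    by (rule open_cblinfun_def)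
  show "(norm S = 0) = (S = 0)"
    by transfer (auto simp: bounded_clinear_def onorm_eq_0)
  show "norm (S + T) \<le> norm S + norm T"
    by transfer (auto simp: bounded_clinear_def intro: onorm_triangle)
  have N: "norm (c *\<^sub>C S) = cmod c * norm S" for c and S :: "'a \<Rightarrow>\<^sub>\<complex> 'b"
  proof -
    have le: "norm (c *\<^sub>C S) \<le> cmod c * norm S" for c and S :: "'a \<Rightarrow>\<^sub>\<complex> 'b"
    proof transfer
      fix c and f :: "'a \<Rightarrow> 'b" assume "bounded_clinear f"
      then have f: "bounded_linear f" by (simp add: bounded_clinear_def)
      show "onorm (\<lambda>x. c *\<^sub>C f x) \<le> cmod c * onorm f"
      proof (rule onorm_bound)
        show "0 \<le> cmod c * onorm f" using onorm_pos_le[OF f] by simp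
        fix x show "norm (c *\<^sub>C f x) \<le> cmod c * onorm f * norm x"
          using mult_left_mono[OF onorm[OF f, of x], of "cmod c"]
          by (simp add: norm_scaleC mult.assoc)
      qed
    qed
    show ?thesis
    proof (cases "c = 0")
      case True
      have "(0 :: complex) *\<^sub>C S = 0" by transfer simp
      moreover have "norm (0 :: 'a \<Rightarrow>\<^sub>\<complex> 'b) = 0" by transfer (rule onorm_zero)
      ultimately show ?thesis using True by simp
    next
      case False
      have "S = inverse c *\<^sub>C c *\<^sub>C S"
        using False by transfer (simp add: scaleC_scaleC scaleC_one)
      then have "norm S \<le> cmod (inverse c) * norm (c *\<^sub>C S)"
        using le[of "inverse c" "c *\<^sub>C S"] by simp
      then have "cmod c * norm S \<le> cmod c * (cmod (inverse c) * norm (c *\<^sub>C S))"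
        by (rule mult_left_mono) simp
      also have "\<dots> = norm (c *\<^sub>C S)"
        using False by (simp add: norm_inverse)
      finally have "cmod c * norm S \<le> norm (c *\<^sub>C S)" .
      with le[of c S] show ?thesis by simp
    qed
  qed
  then show "norm (c *\<^sub>C S) = cmod c * norm S" .
  show "norm (a *\<^sub>R S) = \<bar>a\<bar> * norm S"
    by (simp add: R N)
qed

end

lemma norm_cblinfun_apply: "norm (cblinfun_apply T x) \<le> norm T * norm x"
  by transfer (auto simp: bounded_clinear_def intro: onorm)

lemma norm_cblinfun_bound:
  "0 \<le> b \<Longrightarrow> (\<And>x. norm (cblinfun_apply T x) \<le> b * norm x) \<Longrightarrow> norm T \<le> b"
  by transfer (rule onorm_bound)

lemma cblinfun_apply_minus: "cblinfun_apply (S - T) x = cblinfun_apply S x - cblinfun_apply T x"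
  by transfer simp

lemma cblinfun_apply_plus: "cblinfun_apply (S + T) x = cblinfun_apply S x + cblinfun_apply T x"
  by transfer simp

lemma cblinfun_apply_scaleC_left: "cblinfun_apply (c *\<^sub>C T) x = c *\<^sub>C cblinfun_apply T x"
  by transfer simp

instance cblinfun :: (complex_normed_vector, cbanach) cbanach
proof
  fix X :: "nat \<Rightarrow> 'a \<Rightarrow>\<^sub>\<complex> 'b"
  assume X: "Cauchy X"
  define Y where "Y n = Blinfun (cblinfun_apply (X n))" for n
  have Y: "blinfun_apply (Y n) = cblinfun_apply (X n)" for n
    unfolding Y_def by (rule bounded_linear_Blinfun_apply[OF bounded_linear_cblinfun_apply])
  have "norm (Y m - Y n) = norm (X m - X n)" for m n
    by (simp add: norm_blinfun.rep_eq norm_cblinfun.rep_eq minus_blinfun.rep_eq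
        minus_cblinfun.rep_eq Y)
  with X have "Cauchy Y"
    by (simp add: Cauchy_def dist_norm)
  then obtain L where L: "Y \<longlonglongrightarrow> L"
    using Cauchy_convergent convergent_def by blast
  have lim: "(\<lambda>n. cblinfun_apply (X n) x) \<longlonglongrightarrow> blinfun_apply L x" for x
    using blinfun.tendsto[OF L tendsto_const[of x]] by (simp add: Y)
  have "bounded_clinear (blinfun_apply L)"
    unfolding bounded_clinear_def
  proof (intro conjI allI)
    show "bounded_linear (blinfun_apply L)" by (rule blinfun.bounded_linear_right)
    fix c x
    have "(\<lambda>n. c *\<^sub>C cblinfun_apply (X n) x) \<longlonglongrightarrow> c *\<^sub>C blinfun_apply L x"
      by (rule bounded_linear.tendsto[OF bounded_linear_scaleC_right lim])
    then show "blinfun_apply L (c *\<^sub>C x) = c *\<^sub>C blinfun_apply L x"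
      using LIMSEQ_unique[OF lim[of "c *\<^sub>C x"]] by (simp add: cblinfun_apply_scaleC)
  qed
  then have M: "cblinfun_apply (CBlinfun (blinfun_apply L)) = blinfun_apply L"
    by (rule cblinfun_apply_CBlinfun)
  have "norm (X n - CBlinfun (blinfun_apply L)) = norm (Y n - L)" for n
    by (simp add: norm_blinfun.rep_eq norm_cblinfun.rep_eq minus_blinfun.rep_eq
        minus_cblinfun.rep_eq Y M)
  with L have "X \<longlonglongrightarrow> CBlinfun (blinfun_apply L)"
    by (simp add: LIMSEQ_iff)
  then show "convergent X" by (auto simp: convergent_def)
qed

lift_definition cblinfun_id :: "'a :: complex_normed_vector \<Rightarrow>\<^sub>\<complex> 'a" is "\<lambda>x. x"
  by (simp add: bounded_clinear_def)

lift_definition cblinfun_compose ::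
    "('b :: complex_normed_vector) \<Rightarrow>\<^sub>\<complex> 'c \<Rightarrow> 'a \<Rightarrow>\<^sub>\<complex> 'b \<Rightarrow>
      ('a :: complex_normed_vector \<Rightarrow>\<^sub>\<complex> 'c :: complex_normed_vector)"  (infixl \<open>o\<^sub>C\<close> 67)
  is "\<lambda>f g x. f (g x)"
  by (auto simp: bounded_clinear_def intro: bounded_linear_compose)

lemma norm_cblinfun_compose: "norm (S o\<^sub>C T) \<le> norm S * norm T"
proof (rule norm_cblinfun_bound)
  show "norm (cblinfun_apply (S o\<^sub>C T) x) \<le> norm S * norm T * norm x" for x
    using norm_cblinfun_apply[of S "cblinfun_apply T x"]
      mult_left_mono[OF norm_cblinfun_apply[of T x] norm_ge_zero[of S]]
    by (simp add: cblinfun_compose.rep_eq mult.assoc)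
qed simp

text \<open>The Banach space adjoint acts on the dual \<open>L(Y, \<complex>)\<close> by \<open>\<phi> \<mapsto> \<phi> \<circ> B\<close>; it is
  complex linear in \<open>\<phi>\<close>, with no conjugation.\<close>

definition cblinfun_adjoint ::
    "('a :: complex_normed_vector) \<Rightarrow>\<^sub>\<complex> ('b :: complex_normed_vector) \<Rightarrow>
      ('b \<Rightarrow>\<^sub>\<complex> complex) \<Rightarrow>\<^sub>\<complex> ('a \<Rightarrow>\<^sub>\<complex> complex)"
  where "cblinfun_adjoint B = CBlinfun (\<lambda>\<phi>. \<phi> o\<^sub>C B)"

lemma cblinfun_adjoint_apply: "cblinfun_apply (cblinfun_adjoint B) \<phi> = \<phi> o\<^sub>C B"
proof -
  have "bounded_clinear (\<lambda>\<phi> :: 'b \<Rightarrow>\<^sub>\<complex> complex. \<phi> o\<^sub>C B)"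
    unfolding bounded_clinear_def
  proof (intro conjI allI)
    show S: "(c *\<^sub>C \<phi>) o\<^sub>C B = c *\<^sub>C (\<phi> o\<^sub>C B)" for c and \<phi> :: "'b \<Rightarrow>\<^sub>\<complex> complex"
      by transfer simp
    show "bounded_linear (\<lambda>\<phi> :: 'b \<Rightarrow>\<^sub>\<complex> complex. \<phi> o\<^sub>C B)"
    proof (rule bounded_linear_intro[where K = "norm B"])
      show "(\<phi> + \<psi>) o\<^sub>C B = \<phi> o\<^sub>C B + \<psi> o\<^sub>C B" for \<phi> \<psi> :: "'b \<Rightarrow>\<^sub>\<complex> complex"
        by transfer simp
      show "(r *\<^sub>R \<phi>) o\<^sub>C B = r *\<^sub>R (\<phi> o\<^sub>C B)" for r and \<phi> :: "'b \<Rightarrow>\<^sub>\<complex> complex"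
        by (simp add: scaleR_scaleC S)
      show "norm (\<phi> o\<^sub>C B) \<le> norm \<phi> * norm B" for \<phi> :: "'b \<Rightarrow>\<^sub>\<complex> complex"
        by (rule norm_cblinfun_compose)
    qed
  qed
  then show ?thesis
    by (simp add: cblinfun_adjoint_def cblinfun_apply_CBlinfun)
qed

definition generalized_derivation ::
    "('x :: complex_normed_vector) \<Rightarrow>\<^sub>\<complex> 'x \<Rightarrow> ('y :: complex_normed_vector) \<Rightarrow>\<^sub>\<complex> 'y \<Rightarrow>
      ('y \<Rightarrow>\<^sub>\<complex> 'x) \<Rightarrow>\<^sub>\<complex> ('y \<Rightarrow>\<^sub>\<complex> 'x)"
  where "generalized_derivation A B = CBlinfun (\<lambda>U. A o\<^sub>C U - U o\<^sub>C B)"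

lemma generalized_derivation_apply:
  "cblinfun_apply (generalized_derivation A B) U = A o\<^sub>C U - U o\<^sub>C B"
proof -
  have "bounded_clinear (\<lambda>U. A o\<^sub>C U - U o\<^sub>C B)"
    unfolding bounded_clinear_def
  proof (intro conjI allI)
    show S: "A o\<^sub>C (c *\<^sub>C U) - (c *\<^sub>C U) o\<^sub>C B = c *\<^sub>C (A o\<^sub>C U - U o\<^sub>C B)" for c U
      by (rule cblinfun_eqI)
        (simp add: cblinfun_compose.rep_eq cblinfun_apply_minus cblinfun_apply_scaleC_left
          cblinfun_apply_scaleC complex_vector.scale_right_diff_distrib)
    show "bounded_linear (\<lambda>U. A o\<^sub>C U - U o\<^sub>C B)"
    proof (rule bounded_linear_intro[where K = "norm A + norm B"])
      show "A o\<^sub>C (U + V) - (U + V) o\<^sub>C B = (A o\<^sub>C U - U o\<^sub>C B) + (A o\<^sub>C V - V o\<^sub>C B)" for U V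
        by (rule cblinfun_eqI)
          (simp add: cblinfun_compose.rep_eq cblinfun_apply_minus cblinfun_apply_plus
            linear_add[OF bounded_linear.linear[OF bounded_linear_cblinfun_apply]])
      show "A o\<^sub>C (r *\<^sub>R U) - (r *\<^sub>R U) o\<^sub>C B = r *\<^sub>R (A o\<^sub>C U - U o\<^sub>C B)" for r U
        unfolding scaleR_scaleC by (rule S)
      show "norm (A o\<^sub>C U - U o\<^sub>C B) \<le> norm U * (norm A + norm B)" for U
        using norm_triangle_ineq4[of "A o\<^sub>C U" "U o\<^sub>C B"]
          norm_cblinfun_compose[of A U] norm_cblinfun_compose[of U B]
        by (simp add: algebra_simps)
    qed
  qed
  then show ?thesis
    by (simp add: generalized_derivation_def cblinfun_apply_CBlinfun)
qed

section \<open>Dimension and codimension\<close>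

definition fin_dim :: "'a :: complex_normed_vector set \<Rightarrow> bool"
  where "fin_dim V \<longleftrightarrow> (\<exists>S. finite S \<and> V \<subseteq> complex_vector.span S)"

definition edim :: "'a :: complex_normed_vector set \<Rightarrow> enat"
  where "edim V = (if fin_dim V then enat (complex_vector.dim V) else \<infinity>)"

definition is_complement ::
    "'a :: complex_normed_vector set \<Rightarrow> 'a set \<Rightarrow> 'a set \<Rightarrow> bool"
  where "is_complement V W C \<longleftrightarrow> complex_vector.subspace C \<and> C \<subseteq> V \<and> W \<inter> C = {0} \<and>
    V = {w + c | w c. w \<in> W \<and> c \<in> C}"

text \<open>The codimension of a subspace \<open>W\<close> of \<open>V\<close>, i.e. \<open>dim (V / W)\<close>, is the dimension of any
  algebraic complement of \<open>W\<close> in \<open>V\<close>; see \<open>ex_complement\<close> and \<open>codim_in_eq_edim\<close> below.\<close>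

definition codim_in :: "'a :: complex_normed_vector set \<Rightarrow> 'a set \<Rightarrow> enat"
  where "codim_in V W = (THE d. \<exists>C. is_complement V W C \<and> d = edim C)"

lemma ex_complement:
  assumes V: "complex_vector.subspace V" and W: "complex_vector.subspace W" and WV: "W \<subseteq> V"
  shows "\<exists>C. is_complement V W C"
proof -
  obtain B where B: "B \<subseteq> W" "complex_vector.independent B" "W \<subseteq> complex_vector.span B"
    by (rule complex_vector.maximal_independent_subset)
  obtain D where D: "B \<subseteq> D" "D \<subseteq> V" "complex_vector.independent D" "V \<subseteq> complex_vector.span D"
    using complex_vector.maximal_independent_subset_extend[of B V] B WV by blast
  have sB: "complex_vector.span B = W"
    using B W by (simp add: complex_vector.span_subspace)
  have sD: "complex_vector.span D = V"
    using D V by (simp add: complex_vector.span_subspace)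
  let ?C = "complex_vector.span (D - B)"
  have "D = B \<union> (D - B)" using D by blast
  then have "V = {w + c | w c. w \<in> W \<and> c \<in> ?C}"
    using complex_vector.span_Un[of B "D - B"] sB sD by (auto; metis)
  moreover have "W \<inter> ?C \<subseteq> {0}"
  proof
    fix x assume x: "x \<in> W \<inter> ?C"
    then have xB: "x \<in> complex_vector.span B" and xD: "x \<in> complex_vector.span (D - B)"
      using sB by auto
    have "complex_vector.representation D x = complex_vector.representation B x"
      by (rule complex_vector.representation_extend[OF D(3) xB D(1)])
    moreover have "complex_vector.representation D x = complex_vector.representation (D - B) x"
      by (rule complex_vector.representation_extend[OF D(3) xD]) blast
    ultimately have "complex_vector.representation D x b = 0" for b
      using complex_vector.representation_ne_zero[of B x b]
        complex_vector.representation_ne_zero[of "D - B" x b] by auto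
    moreover have "x \<in> complex_vector.span D"
      using xD complex_vector.span_mono[of "D - B" D] by blast
    ultimately have "x = 0"
      using complex_vector.sum_nonzero_representation_eq[OF D(3), of x] by simp
    then show "x \<in> {0}" by simp
  qed
  moreover have "0 \<in> W \<inter> ?C"
    using W by (simp add: complex_vector.subspace_0 complex_vector.span_zero)
  moreover have "?C \<subseteq> V"
    using sD complex_vector.span_mono[of "D - B" D] by blast
  ultimately have "is_complement V W ?C"
    by (auto simp: is_complement_def)
  then show ?thesis ..
qed

lemma edim_le_if_complements:
  assumes V: "is_complement V W C" "is_complement V W C'"
    and W: "complex_vector.subspace W"
  shows "edim C' \<le> edim C"
proof (cases "fin_dim C")
  case False
  then show ?thesis by (simp add: edim_def)
next
  case True
  obtain S where S: "S \<subseteq> C" "complex_vector.independent S" "C \<subseteq> complex_vector.span S"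
      "card S = complex_vector.dim C"
    by (rule complex_vector.basis_exists)
  have fS: "finite S"
    using True S complex_vector.independent_span_bound[of _ S]
    unfolding fin_dim_def by (meson subset_trans)
  have C: "complex_vector.subspace C" "C \<subseteq> V" "W \<inter> C = {0}"
      "V = {w + c | w c. w \<in> W \<and> c \<in> C}"
    and C': "complex_vector.subspace C'" "C' \<subseteq> V" "W \<inter> C' = {0}"
      "V = {w + c | w c. w \<in> W \<and> c \<in> C'}"
    using V by (auto simp: is_complement_def)
  have "\<forall>s\<in>S. \<exists>c\<in>C'. s - c \<in> W"
  proof
    fix s assume "s \<in> S"
    then have "s \<in> V" using S C by blast
    then obtain w c where "s = w + c" "w \<in> W" "c \<in> C'" using C'(4) by blast
    then show "\<exists>c\<in>C'. s - c \<in> W" by (intro bexI[of _ c]) auto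
  qed
  then obtain p where p: "\<And>s. s \<in> S \<Longrightarrow> p s \<in> C'" "\<And>s. s \<in> S \<Longrightarrow> s - p s \<in> W"
    by metis
  have sub: "C' \<subseteq> complex_vector.span (p ` S)"
  proof
    fix x assume x: "x \<in> C'"
    then have "x \<in> V" using C'(2) by blast
    then obtain w c where wc: "x = w + c" "w \<in> W" "c \<in> C" using C(4) by blast
    have "c \<in> complex_vector.span S" using wc S by blast
    then obtain r where r: "c = (\<Sum>s\<in>S. r s *\<^sub>C s)"
      using complex_vector.span_finite[OF fS] by auto
    let ?y = "\<Sum>s\<in>S. r s *\<^sub>C p s"
    have y: "?y \<in> C'"
      by (intro complex_vector.subspace_sum complex_vector.subspace_scale C'(1) p)
    have "c - ?y = (\<Sum>s\<in>S. r s *\<^sub>C (s - p s))"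
      by (simp add: r sum_subtractf complex_vector.scale_right_diff_distrib)
    also have "\<dots> \<in> W"
      by (intro complex_vector.subspace_sum complex_vector.subspace_scale W p)
    finally have "w + (c - ?y) \<in> W"
      using wc W by (simp add: complex_vector.subspace_add)
    then have "x - ?y \<in> W" by (simp add: wc algebra_simps)
    moreover have "x - ?y \<in> C'"
      using x y C'(1) by (simp add: complex_vector.subspace_diff)
    ultimately have "x - ?y \<in> W \<inter> C'" by (rule IntI)
    then have "x - ?y = 0" unfolding C'(3) by (rule singletonD)
    then have "x = ?y" by (rule eq_iff_diff_eq_0[THEN iffD2])
    moreover have "?y \<in> complex_vector.span (p ` S)"
      by (intro complex_vector.span_sum complex_vector.span_scale complex_vector.span_base) auto
    ultimately show "x \<in> complex_vector.span (p ` S)" by simp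
  qed
  have "complex_vector.dim C' \<le> card (p ` S)"
    by (rule complex_vector.dim_le_card[OF sub]) (simp add: fS)
  also have "\<dots> \<le> card S" by (rule card_image_le[OF fS])
  finally have "complex_vector.dim C' \<le> complex_vector.dim C" by (simp add: S)
  moreover have "fin_dim C'" using sub fS unfolding fin_dim_def by blast
  ultimately show ?thesis using True by (simp add: edim_def)
qed

lemma codim_in_eq_edim:
  assumes "is_complement V W C" "complex_vector.subspace W"
  shows "codim_in V W = edim C"
  unfolding codim_in_def
  by (rule the_equality) (use assms in \<open>auto intro: antisym edim_le_if_complements\<close>)

section \<open>Fredholm properties of induced operators\<close>

text \<open>For a subspace \<open>M\<close> with \<open>T M \<subseteq> M\<close>, the constants below describe the operator
  \<open>T|M : M \<rightarrow> M\<close>; for \<open>M = UNIV\<close> they describe \<open>T\<close> itself.\<close>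

definition null_space_on :: "'a set \<Rightarrow> ('a \<Rightarrow>\<^sub>\<complex> 'a) \<Rightarrow> 'a :: complex_normed_vector set"
  where "null_space_on M T = {x \<in> M. cblinfun_apply T x = 0}"

definition range_on :: "'a set \<Rightarrow> ('a \<Rightarrow>\<^sub>\<complex> 'a) \<Rightarrow> 'a :: complex_normed_vector set"
  where "range_on M T = cblinfun_apply T ` M"

definition alpha_on :: "'a set \<Rightarrow> ('a :: complex_normed_vector \<Rightarrow>\<^sub>\<complex> 'a) \<Rightarrow> enat"
  where "alpha_on M T = edim (null_space_on M T)"

definition beta_on :: "'a set \<Rightarrow> ('a :: complex_normed_vector \<Rightarrow>\<^sub>\<complex> 'a) \<Rightarrow> enat"
  where "beta_on M T = codim_in M (range_on M T)"

text \<open>Only used when \<open>alpha_on M T\<close> is finite, so that the value is an integer or \<open>-\<infinity>\<close>.\<close>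

definition ind_on :: "'a set \<Rightarrow> ('a :: complex_normed_vector \<Rightarrow>\<^sub>\<complex> 'a) \<Rightarrow> ereal"
  where "ind_on M T = ereal_of_enat (alpha_on M T) - ereal_of_enat (beta_on M T)"

definition upper_semi_fredholm_on ::
    "'a set \<Rightarrow> ('a :: complex_normed_vector \<Rightarrow>\<^sub>\<complex> 'a) \<Rightarrow> bool"
  where "upper_semi_fredholm_on M T \<longleftrightarrow>
    closedin (top_of_set M) (range_on M T) \<and> alpha_on M T < \<infinity>"

primrec cblinfun_power ::
    "'a \<Rightarrow>\<^sub>\<complex> 'a \<Rightarrow> nat \<Rightarrow> ('a :: complex_normed_vector \<Rightarrow>\<^sub>\<complex> 'a)"  (infixr \<open>^\<^sub>C\<close> 80)
  where
    "T ^\<^sub>C 0 = cblinfun_id"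
  | "T ^\<^sub>C Suc n = T o\<^sub>C T ^\<^sub>C n"

abbreviation null_space :: "('a \<Rightarrow>\<^sub>\<complex> 'a) \<Rightarrow> 'a :: complex_normed_vector set"
  where "null_space \<equiv> null_space_on UNIV"

abbreviation op_range :: "('a \<Rightarrow>\<^sub>\<complex> 'a) \<Rightarrow> 'a :: complex_normed_vector set"
  where "op_range \<equiv> range_on UNIV"

definition bounded_below :: "('a :: complex_normed_vector \<Rightarrow>\<^sub>\<complex> 'a) \<Rightarrow> bool"
  where "bounded_below T \<longleftrightarrow> null_space T = {0} \<and> closed (op_range T)"

definition semi_b_fredholm_degree ::
    "nat \<Rightarrow> ('a :: complex_normed_vector \<Rightarrow>\<^sub>\<complex> 'a) \<Rightarrow> bool"
  where "semi_b_fredholm_degree n T \<longleftrightarrow>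
    closed (op_range (T ^\<^sub>C n)) \<and> upper_semi_fredholm_on (op_range (T ^\<^sub>C n)) T"

definition upper_semi_b_fredholm :: "('a :: complex_normed_vector \<Rightarrow>\<^sub>\<complex> 'a) \<Rightarrow> bool"
  where "upper_semi_b_fredholm T \<longleftrightarrow> (\<exists>n. semi_b_fredholm_degree n T)"

text \<open>The index of \<open>T|R(T^n)\<close> does not depend on the admissible exponent \<open>n\<close>; the least
  one is used.\<close>

definition b_fredholm_index :: "('a :: complex_normed_vector \<Rightarrow>\<^sub>\<complex> 'a) \<Rightarrow> ereal"
  where "b_fredholm_index T = ind_on (op_range (T ^\<^sub>C (LEAST n. semi_b_fredholm_degree n T))) T"

section \<open>Spectra and generalized Weyl and Browder type theorems\<close>

abbreviation shift_by :: "('a :: complex_normed_vector \<Rightarrow>\<^sub>\<complex> 'a) \<Rightarrow> complex \<Rightarrow> 'a \<Rightarrow>\<^sub>\<complex> 'a"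
  where "shift_by T \<mu> \<equiv> T - \<mu> *\<^sub>C cblinfun_id"

definition sigma_a :: "('a :: complex_normed_vector \<Rightarrow>\<^sub>\<complex> 'a) \<Rightarrow> complex set"
  where "sigma_a T = {\<mu>. \<not> bounded_below (shift_by T \<mu>)}"

definition sigma_SBF :: "('a :: complex_normed_vector \<Rightarrow>\<^sub>\<complex> 'a) \<Rightarrow> complex set"
  where "sigma_SBF T =
    {\<mu>. \<not> upper_semi_b_fredholm (shift_by T \<mu>) \<or> 0 < b_fredholm_index (shift_by T \<mu>)}"

definition asc :: "('a :: complex_normed_vector \<Rightarrow>\<^sub>\<complex> 'a) \<Rightarrow> enat"
  where "asc T = (if \<exists>a. null_space (T ^\<^sub>C a) = null_space (T ^\<^sub>C (a + 1))
    then enat (LEAST a. null_space (T ^\<^sub>C a) = null_space (T ^\<^sub>C (a + 1))) else \<infinity>)"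

definition Pi_a :: "('a :: complex_normed_vector \<Rightarrow>\<^sub>\<complex> 'a) \<Rightarrow> complex set"
  where "Pi_a T = {\<mu> \<in> isolated_points_of (sigma_a T).
    \<exists>a. asc (shift_by T \<mu>) = enat a \<and> closed (op_range (shift_by T \<mu> ^\<^sub>C (a + 1)))}"

definition E_a :: "('a :: complex_normed_vector \<Rightarrow>\<^sub>\<complex> 'a) \<Rightarrow> complex set"
  where "E_a T = {\<mu> \<in> isolated_points_of (sigma_a T). 0 < alpha_on UNIV (shift_by T \<mu>)}"

definition a_isoloid :: "('a :: complex_normed_vector \<Rightarrow>\<^sub>\<complex> 'a) \<Rightarrow> bool"
  where "a_isoloid T \<longleftrightarrow> isolated_points_of (sigma_a T) = E_a T"

definition generalized_a_Browder :: "('a :: complex_normed_vector \<Rightarrow>\<^sub>\<complex> 'a) \<Rightarrow> bool"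
  where "generalized_a_Browder T \<longleftrightarrow> sigma_SBF T = sigma_a T - Pi_a T"

definition generalized_a_Weyl :: "('a :: complex_normed_vector \<Rightarrow>\<^sub>\<complex> 'a) \<Rightarrow> bool"
  where "generalized_a_Weyl T \<longleftrightarrow> sigma_SBF T = sigma_a T - E_a T"

text \<open>The set of differences \<open>s - t\<close>, as opposed to the set difference written \<open>S - T\<close> above.\<close>

definition difference_set :: "complex set \<Rightarrow> complex set \<Rightarrow> complex set"
  where "difference_set S T = {s - t | s t. s \<in> S \<and> t \<in> T}"

end

theory Submission
  imports Defs
begin

text \<open>Under the hypotheses, the set \<open>\<sigma>_SBF\<close> of \<open>A\<close> and of the adjoint of \<open>B\<close> consists of the limit
  points of the approximate point spectrum. That spectrum of \<open>\<rho>\<close> is the difference set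
  of those of \<open>A\<close> and of the adjoint of \<open>B\<close>, and by compactness the limit points of the
  difference set are exactly the right-hand side of (ii). Rank one operators built from eigenvectors
  show that \<open>\<rho>\<close> is \<open>a\<close>-isoloid, so (i) also says that \<open>\<sigma>_SBF(\<rho>)\<close> is the set of limit points. That
  (i) implies the Browder property holds for every operator: if \<open>T - \<mu>\<close> is upper semi B-Fredholm
  and \<open>\<mu>\<close> is isolated in the approximate point spectrum, then \<open>T - \<mu>\<close> has finite ascent.\<close>

section \<open>Norming functionals\<close>

text \<open>The hard point is that \<open>sigma_a\<close> of the derivation contains nothing but
  differences. Left multiplication L by A and right multiplication R by B commute; an approximate
  eigenvector of L - R for \<mu> has to be refined to one that is also approximate for L at some s,
  hence for R at s - \<mu>. The usual route passes to bounded sequences modulo null sequences,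
  restricts L to the kernel of L - R - \<mu>, and uses that an operator on a nonzero Banach space
  has nonempty approximate point spectrum. Here only the polynomial orbit of one sequence is kept:
  the quotient norm becomes a seminorm on complex polynomials, and nonemptiness becomes a statement
  about such seminorms. A lower bound for the adjoint of B passes to right multiplication by B
  through functionals that norm the vectors U y, whence the Hahn-Banach theorem. The open mapping
  theorem turns injectivity with closed range into a norm estimate that survives perturbation; it
  also controls the closed ranges in the ascent argument.\<close>

definition sublinear :: "('a :: real_vector \<Rightarrow> real) \<Rightarrow> bool"
  where "sublinear p \<longleftrightarrow>
    (\<forall>x y. p (x + y) \<le> p x + p y) \<and> (\<forall>t x. 0 \<le> t \<longrightarrow> p (t *\<^sub>R x) = t * p x)"

text \<open>The bound at \<open>inverse t\<close> and \<open>t *\<^sub>R x\<close> is the reverse of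
  the bound at t and x, so only one direction has to be checked for functionals defined by
  infima.\<close>

lemma sublinear_homogeneousI:
  assumes "\<And>x y. p (x + y) \<le> p x + p y" and "p 0 = 0"
    and ge: "\<And>t x. 0 < t \<Longrightarrow> t * p x \<le> p (t *\<^sub>R x)"
  shows "sublinear p"
proof -
  have "p (t *\<^sub>R x) = t * p x" if "0 < t" for t x
    using ge[of t x] ge[of "inverse t" "t *\<^sub>R x"] that by (simp add: field_simps)
  then have "p (t *\<^sub>R x) = t * p x" if "0 \<le> t" for t x
    using that assms(2) by (cases "t = 0") auto
  then show ?thesis
    using assms(1) by (simp add: sublinear_def)
qed

lemma sublinear_zero: "sublinear p \<Longrightarrow> p 0 = 0"
  unfolding sublinear_def by (metis mult_zero_left order_refl scaleR_zero_left)

lemma sublinear_ge_neg: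
  assumes "sublinear p"
  shows "- p (- x) \<le> p x"
proof -
  have "p (x + - x) \<le> p x + p (- x)" using assms unfolding sublinear_def by blast
  then show ?thesis using sublinear_zero[OF assms] by simp
qed

text \<open>The r constructed here is the largest sublinear functional below p with
  \<open>r (- y) \<le> - p y\<close>. Its infimum is finite because - p (- x) bounds all terms from
  below. It serves twice: it makes a minimal functional odd, and, started from the norm, it fixes
  the value at the vector to be normed.\<close>

lemma sublinear_decrease:
  assumes p: "sublinear p"
  obtains r where "sublinear r" "\<And>x. r x \<le> p x" "r (- y) \<le> - p y"
proof -
  have sub: "p (x + y) \<le> p x + p y" for x y using p by (simp add: sublinear_def)
  have hom: "0 \<le> t \<Longrightarrow> p (t *\<^sub>R x) = t * p x" for t x using p by (simp add: sublinear_def)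
  define r where "r x = (INF t\<in>{0..}. p (x + t *\<^sub>R y) - t * p y)" for x
  have "- p (- x) \<le> p (x + t *\<^sub>R y) - t * p y" if "0 \<le> t" for x t
    using sub[of "x + t *\<^sub>R y" "- x"] hom[OF that, of y] by simp
  then have bdd: "bdd_below ((\<lambda>t. p (x + t *\<^sub>R y) - t * p y) ` {0..})" for x
    by (intro bdd_belowI2[of _ "- p (- x)"]) auto
  have r_le: "r x \<le> p (x + t *\<^sub>R y) - t * p y" if "0 \<le> t" for x t
    unfolding r_def using that by (intro cINF_lower bdd) auto
  have r_ge: "c \<le> r x" if "\<And>t. 0 \<le> t \<Longrightarrow> c \<le> p (x + t *\<^sub>R y) - t * p y" for c x
    unfolding r_def using that by (intro cINF_greatest) auto
  have "sublinear r"
  proof (rule sublinear_homogeneousI)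
    fix a b
    have "r (a + b) - (p (b + t *\<^sub>R y) - t * p y) \<le> r a" if t: "0 \<le> t" for t
    proof (rule r_ge)
      fix s :: real assume s: "0 \<le> s"
      have "r (a + b) \<le> p (a + b + (s + t) *\<^sub>R y) - (s + t) * p y"
        using s t by (intro r_le) auto
      also have "p (a + b + (s + t) *\<^sub>R y) \<le> p (a + s *\<^sub>R y) + p (b + t *\<^sub>R y)"
        using sub[of "a + s *\<^sub>R y" "b + t *\<^sub>R y"] by (simp add: algebra_simps)
      finally show "r (a + b) - (p (b + t *\<^sub>R y) - t * p y) \<le> p (a + s *\<^sub>R y) - s * p y"
        by (simp add: algebra_simps)
    qed
    then have "r (a + b) - r a \<le> r b" by (intro r_ge) (simp add: algebra_simps)
    then show "r (a + b) \<le> r a + r b" by simp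
  next
    show "r 0 = 0"
      using r_le[of 0 0] sublinear_zero[OF p] by (intro antisym r_ge) (auto simp: hom)
  next
    fix s x assume s: "(0 :: real) < s"
    show "s * r x \<le> r (s *\<^sub>R x)"
    proof (rule r_ge)
      fix t :: real assume t: "0 \<le> t"
      have "s * r x \<le> s * (p (x + (t / s) *\<^sub>R y) - (t / s) * p y)"
        using s t by (intro mult_left_mono r_le) auto
      also have "\<dots> = p (s *\<^sub>R x + t *\<^sub>R y) - t * p y"
        using s hom[of s "x + (t / s) *\<^sub>R y"] by (simp add: algebra_simps)
      finally show "s * r x \<le> p (s *\<^sub>R x + t *\<^sub>R y) - t * p y" .
    qed
  qed
  moreover have "r x \<le> p x" for x using r_le[of 0 x] by simp
  moreover have "r (- y) \<le> - p y" using r_le[of 1 "- y"] sublinear_zero[OF p] by simp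
  ultimately show ?thesis by (rule that)
qed

text \<open>Minimality identifies p with the functional of \<open>sublinear_decrease\<close> at y,
  so p is odd; oddness turns subadditivity into additivity.\<close>

lemma sublinear_minimal_imp_linear:
  assumes p: "sublinear p" and min: "\<And>r. sublinear r \<Longrightarrow> (\<And>x. r x \<le> p x) \<Longrightarrow> r = p"
  shows "linear p"
proof -
  have sub: "p (x + y) \<le> p x + p y" for x y using p by (simp add: sublinear_def)
  have hom: "0 \<le> t \<Longrightarrow> p (t *\<^sub>R x) = t * p x" for t x using p by (simp add: sublinear_def)
  have neg: "p (- y) = - p y" for y
  proof -
    obtain r where "sublinear r" "\<And>x. r x \<le> p x" "r (- y) \<le> - p y"
      using sublinear_decrease[OF p, of y] by blast
    with min have "p (- y) \<le> - p y" by metis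
    with sublinear_ge_neg[OF p, of y] show ?thesis by simp
  qed
  show ?thesis
  proof (rule linearI)
    fix x y show "p (x + y) = p x + p y"
      using sub[of x y] sub[of "x + y" "- y"] by (simp add: neg)
  next
    fix c x show "p (c *\<^sub>R x) = c *\<^sub>R p x"
    proof (cases "0 \<le> c")
      case False
      then show ?thesis using hom[of "- c" "x"] neg[of "c *\<^sub>R x"] by simp
    qed (simp add: hom)
  qed
qed

text \<open>Zorn's lemma gives a minimal sublinear functional below the one that \<open>sublinear_decrease\<close>
  produces from the norm; by minimality it is linear.\<close>

lemma Hahn_Banach_norming_real:
  fixes z :: "'a :: real_normed_vector"
  shows "\<exists>f. linear f \<and> (\<forall>x. \<bar>f x\<bar> \<le> norm x) \<and> f z = norm z"
proof -
  define S where "S = {p. sublinear p \<and> (\<forall>x. p x \<le> norm x) \<and> p (- z) \<le> - norm z}"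
  \<comment> \<open>The order points downwards, so that the maximal element supplied by
    \<open>predicate_Zorn\<close> is a minimal functional.\<close>
  define P where "P = (\<lambda>(p :: 'a \<Rightarrow> real) r. \<forall>x. r x \<le> p x)"
  have start: "\<exists>p. p \<in> S"
  proof -
    have "sublinear (norm :: 'a \<Rightarrow> real)"
      by (simp add: sublinear_def norm_triangle_ineq)
    then obtain p where "sublinear p" "\<And>x. p x \<le> norm x" "p (- z) \<le> - norm z"
      using sublinear_decrease[of norm z] by blast
    then show ?thesis unfolding S_def by blast
  qed
  \<comment> \<open>This bound does not depend on p, so the pointwise infimum over a chain is
    finite.\<close>
  have lower: "- norm x \<le> p x" if "p \<in> S" for p x
  proof -
    have "- p (- x) \<le> p x" using that by (simp add: S_def sublinear_ge_neg)
    moreover have "p (- x) \<le> norm (- x)" using that unfolding S_def by blast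
    ultimately show ?thesis by simp
  qed
  have "\<exists>m\<in>S. \<forall>a\<in>S. P m a \<longrightarrow> a = m"
  proof (rule predicate_Zorn)
    show "partial_order_on S (relation_of P S)"
      by (rule partial_order_on_relation_ofI) (auto simp: P_def fun_eq_iff intro: order_trans antisym)
  next
    fix C assume C: "C \<in> Chains (relation_of P S)"
    show "\<exists>u\<in>S. \<forall>a\<in>C. P a u"
    proof (cases "C = {}")
      case True then show ?thesis using start by auto
    next
      case False
      have CS: "p \<in> S" if "p \<in> C" for p
        using C that by (auto simp: Chains_def relation_of_def)
      have chain: "P p r \<or> P r p" if "p \<in> C" "r \<in> C" for p r
        using C that by (auto simp: Chains_def relation_of_def)
      define u where "u x = (INF p\<in>C. p x)" for x
      have bdd: "bdd_below ((\<lambda>p. p x) ` C)" for x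
        using CS lower by (intro bdd_belowI2[of _ "- norm x"]) (auto simp: S_def)
      have u_le: "u x \<le> p x" if "p \<in> C" for p x
        unfolding u_def using that by (intro cINF_lower bdd)
      have u_ge: "c \<le> u x" if "\<And>p. p \<in> C \<Longrightarrow> c \<le> p x" for c x
        unfolding u_def using that False by (intro cINF_greatest)
      obtain p where p: "p \<in> C" using False by auto
      have "sublinear u"
      proof (rule sublinear_homogeneousI)
        fix a b
        have *: "u (a + b) - r b \<le> p a" if pr: "p \<in> C" "r \<in> C" for p r
        proof -
          obtain s where s: "s \<in> C" "s a \<le> p a" "s b \<le> r b"
            using chain[OF pr] pr unfolding P_def by (meson order_refl)
          have "u (a + b) \<le> s (a + b)" using s by (intro u_le)
          also have "\<dots> \<le> s a + s b" using CS[OF s(1)] by (auto simp: S_def sublinear_def)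
          finally show ?thesis using s by simp
        qed
        have "u (a + b) - r b \<le> u a" if "r \<in> C" for r
          using * that by (intro u_ge)
        then have "u (a + b) - u a \<le> u b" by (intro u_ge) (simp add: algebra_simps)
        then show "u (a + b) \<le> u a + u b" by simp
      next
        have p0: "p 0 = 0" if "p \<in> C" for p
          using CS[OF that] by (simp add: S_def sublinear_zero)
        have "u 0 \<le> 0" using u_le[OF p, of 0] p0[OF p] by simp
        moreover have "0 \<le> u 0" by (rule u_ge) (simp add: p0)
        ultimately show "u 0 = 0" by simp
      next
        fix t x assume t: "(0 :: real) < t"
        have "p (t *\<^sub>R x) = t * p x" if "p \<in> C" for p
          using CS[OF that] t by (auto simp: S_def sublinear_def)
        moreover have "t * u x \<le> t * p x" if "p \<in> C" for p
          using t u_le[OF that] by (intro mult_left_mono) auto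
        ultimately show "t * u x \<le> u (t *\<^sub>R x)" by (intro u_ge) simp
      qed
      have "u x \<le> norm x" for x
        using u_le[OF p, of x] CS[OF p] order_trans unfolding S_def by blast
      moreover have "u (- z) \<le> - norm z"
        using u_le[OF p, of "- z"] CS[OF p] order_trans unfolding S_def by blast
      ultimately have "u \<in> S" using \<open>sublinear u\<close> by (simp add: S_def)
      then show ?thesis using u_le by (auto simp: P_def)
    qed
  qed
  then obtain m where m: "m \<in> S" "\<And>a. a \<in> S \<Longrightarrow> P m a \<Longrightarrow> a = m" by blast
  have mS: "sublinear m" "\<And>x. m x \<le> norm x" "m (- z) \<le> - norm z" using m(1) by (auto simp: S_def)
  have lin: "linear m"
  proof (rule sublinear_minimal_imp_linear)
    fix r assume r: "sublinear r" "\<And>x. r x \<le> m x"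
    then have "r x \<le> norm x" for x using mS(2) order_trans by blast
    moreover have "r (- z) \<le> - norm z" using r(2) mS(3) order_trans by blast
    ultimately have "r \<in> S" using r(1) by (simp add: S_def)
    with r m(2) show "r = m" by (auto simp: P_def)
  qed (use mS in simp)
  have "\<bar>m x\<bar> \<le> norm x" for x
    using lower[OF m(1), of x] mS(2)[of x] by (simp add: abs_le_iff)
  moreover have "m z = norm z"
    using mS(2)[of z] mS(3) linear_neg[OF lin, of z] by simp
  ultimately show ?thesis using lin by blast
qed

text \<open>A complex-linear functional is determined by its real part g as g(x) - i g(ix), which
  leaves only one candidate. Its value at z has real part norm z, and this already gives the
  required inequality.\<close>

lemma Hahn_Banach_norming:
  fixes z :: "'a :: complex_normed_vector"
  obtains f :: "'a \<Rightarrow>\<^sub>\<complex> complex" where "norm f \<le> 1" "norm z \<le> cmod (cblinfun_apply f z)"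
proof -
  obtain g where g: "linear g" "\<And>x :: 'a. \<bar>g x\<bar> \<le> norm x" "g z = norm z"
    using Hahn_Banach_norming_real by metis
  define f where "f x = complex_of_real (g x) - \<i> * complex_of_real (g (\<i> *\<^sub>C x))" for x :: 'a
  have add: "f (x + y) = f x + f y" for x y
    by (simp add: f_def scaleC_add_right linear_add[OF g(1)] algebra_simps)
  have R: "f (complex_of_real r *\<^sub>C x) = complex_of_real r * f x" for r x
  proof -
    have "\<i> *\<^sub>C complex_of_real r *\<^sub>C x = complex_of_real r *\<^sub>C \<i> *\<^sub>C x"
      by (simp add: scaleC_scaleC mult.commute)
    moreover have "g (complex_of_real r *\<^sub>C y) = r * g y" for y
      using linear_scale[OF g(1), of r y] by (simp add: scaleR_scaleC)
    ultimately show ?thesis by (simp only: f_def) (simp add: algebra_simps)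
  qed
  have I: "f (\<i> *\<^sub>C x) = \<i> * f x" for x
    by (simp add: f_def scaleC_scaleC scaleC_one linear_neg[OF g(1)] algebra_simps)
  have C: "f (c *\<^sub>C x) = c * f x" for c x
  proof -
    have c: "c = complex_of_real (Re c) + complex_of_real (Im c) * \<i>"
      by (simp add: complex_eq_iff)
    have "c *\<^sub>C x = complex_of_real (Re c) *\<^sub>C x + complex_of_real (Im c) *\<^sub>C \<i> *\<^sub>C x"
      by (subst c) (simp only: scaleC_scaleC scaleC_add_left)
    then have "f (c *\<^sub>C x) = complex_of_real (Re c) * f x + complex_of_real (Im c) * (\<i> * f x)"
      by (simp only: add R I)
    also have "\<dots> = c * f x"
      by (subst (3) c) (simp only: distrib_right mult.assoc)
    finally show ?thesis .
  qed
  have bound: "cmod (f x) \<le> norm x" for x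
  proof -
    \<comment> \<open>Rotating f x onto the nonnegative reals reduces the complex bound to the bound
      on the real part.\<close>
    obtain c where c: "cmod c = 1" "c * f x = of_real (cmod (f x))"
    proof (cases "f x = 0")
      case False
      show ?thesis
        by (rule that[of "of_real (cmod (f x)) / f x"]) (use False in \<open>auto simp: norm_divide\<close>)
    qed (auto intro: that[of 1])
    have "cmod (f x) = Re (f (c *\<^sub>C x))" using c by (simp add: C)
    also have "\<dots> \<le> norm (c *\<^sub>C x)" using g(2)[of "c *\<^sub>C x"] by (simp add: f_def)
    finally show ?thesis by (simp add: norm_scaleC c)
  qed
  have bc: "bounded_clinear f"
    unfolding bounded_clinear_def scaleC_complex_def
    by (intro conjI allI C bounded_linear_intro[where K = 1])
      (auto simp: add scaleR_scaleC R bound scaleC_complex_def)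
  show ?thesis
  proof (rule that[of "CBlinfun f"])
    show "norm (CBlinfun f) \<le> 1"
      by (rule norm_cblinfun_bound) (auto simp: cblinfun_apply_CBlinfun[OF bc] bound)
    have "norm z = Re (f z)" by (simp add: f_def g)
    then show "norm z \<le> cmod (cblinfun_apply (CBlinfun f) z)"
      by (simp add: cblinfun_apply_CBlinfun[OF bc] complex_Re_le_cmod)
  qed
qed

section \<open>Open mapping theorem and closed ranges\<close>

lemma complex_subspace_imp_subspace:
  "complex_vector.subspace S \<Longrightarrow> subspace S"
  by (simp add: subspace_def complex_vector.subspace_def scaleR_scaleC)

text \<open>The successive approximation step common to the open mapping theorem and its converse.\<close>

lemma exact_preimage_if_approximate:
  fixes f :: "'a :: banach \<Rightarrow> 'b :: real_normed_vector"
  assumes f: "bounded_linear f" and M: "subspace M" "closed M"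
    and N: "\<And>x y. x \<in> M \<Longrightarrow> y \<in> N \<Longrightarrow> y - f x \<in> N"
    and approx: "\<And>y. y \<in> N \<Longrightarrow> \<exists>x\<in>M. norm x \<le> D * norm y \<and> norm (y - f x) \<le> norm y / 2"
    and y: "y \<in> N"
  shows "\<exists>x\<in>M. f x = y \<and> norm x \<le> 2 * D * norm y"
proof -
  interpret f: bounded_linear f by fact
  obtain g where g: "\<And>y. y \<in> N \<Longrightarrow> g y \<in> M" "\<And>y. y \<in> N \<Longrightarrow> norm (g y) \<le> D * norm y"
    "\<And>y. y \<in> N \<Longrightarrow> norm (y - f (g y)) \<le> norm y / 2"
    using approx by metis
  define Y where "Y n = ((\<lambda>y. y - f (g y)) ^^ n) y" for n
  have Y0: "Y 0 = y" and YS: "Y (Suc n) = Y n - f (g (Y n))" for n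
    by (simp_all add: Y_def)
  have YN: "Y n \<in> N" for n
    by (induction n) (auto simp: Y0 YS y intro: N g)
  have nY: "norm (Y n) \<le> norm y * (1 / 2) ^ n" for n
  proof (induction n)
    case (Suc n)
    have "norm (Y (Suc n)) \<le> norm (Y n) / 2" unfolding YS by (rule g(3)[OF YN])
    with Suc show ?case by simp
  qed (simp add: Y0)
  have D: "0 \<le> D * norm y" using order_trans[OF norm_ge_zero g(2)[OF y]] .
  have ng: "norm (g (Y n)) \<le> D * norm y * (1 / 2) ^ n" for n
  proof (cases "y = 0")
    case True
    then have "Y n = 0" using nY[of n] by simp
    then show ?thesis using g(2)[OF YN[of n]] True by simp
  next
    case False
    then have "0 \<le> D" using D by (simp add: zero_le_mult_iff)
    then show ?thesis
      using order_trans[OF g(2)[OF YN] mult_left_mono[OF nY]] by (simp add: mult.assoc)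
  qed
  have gs: "summable (\<lambda>n. D * norm y * (1 / 2) ^ n)"
    by (intro summable_mult summable_geometric) simp
  have sn: "summable (\<lambda>n. norm (g (Y n)))"
    by (rule summable_comparison_test[OF _ gs]) (use ng in auto)
  then have s: "summable (\<lambda>n. g (Y n))" by (rule summable_norm_cancel)
  define x where "x = (\<Sum>n. g (Y n))"
  have lim: "(\<lambda>n. \<Sum>k<n. g (Y k)) \<longlonglongrightarrow> x"
    using s unfolding x_def by (rule summable_LIMSEQ)
  have "x \<in> M"
    by (rule closed_sequentially[OF M(2) _ lim]) (auto intro!: subspace_sum M(1) g YN)
  moreover have "f x = y"
  proof -
    have "(\<lambda>n. f (\<Sum>k<n. g (Y k))) \<longlonglongrightarrow> f x"
      by (rule f.tendsto[OF lim])
    moreover have "f (\<Sum>k<n. g (Y k)) = y - Y n" for n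
      by (induction n) (auto simp: Y0 YS f.zero f.add)
    moreover have "Y \<longlonglongrightarrow> 0"
    proof (rule Lim_null_comparison)
      show "(\<lambda>n. norm y * (1 / 2) ^ n) \<longlonglongrightarrow> 0"
        by (intro tendsto_mult_right_zero LIMSEQ_power_zero) simp
    qed (use nY in simp)
    then have "(\<lambda>n. y - Y n) \<longlonglongrightarrow> y - 0" by (intro tendsto_intros)
    ultimately show ?thesis using LIMSEQ_unique by fastforce
  qed
  moreover have "norm x \<le> 2 * D * norm y"
  proof -
    have "norm x \<le> (\<Sum>n. norm (g (Y n)))" unfolding x_def by (rule summable_norm[OF sn])
    also have "\<dots> \<le> (\<Sum>n. D * norm y * (1 / 2) ^ n)" by (rule suminf_le[OF ng sn gs])
    also have "\<dots> = 2 * D * norm y"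
      by (subst suminf_mult) (auto simp: suminf_geometric)
    finally show ?thesis .
  qed
  ultimately show ?thesis by blast
qed

text \<open>The open mapping theorem for f on M. Baire's theorem is applied inside the image, which
  is complete because it is closed: the closure of the image of some ball has interior relative to
  it. Differences of points of that closure then approximate every y up to half its norm, and the
  approximation can be iterated.\<close>

lemma bounded_preimages_if_closed_image:
  fixes f :: "'a :: banach \<Rightarrow> 'b :: banach"
  assumes f: "bounded_linear f" and M: "subspace M" "closed M" and cl: "closed (f ` M)"
  shows "\<exists>C>0. \<forall>y\<in>f ` M. \<exists>x\<in>M. f x = y \<and> norm x \<le> C * norm y"
proof -
  interpret f: bounded_linear f by fact
  define N where "N = f ` M"
  have N: "subspace N" unfolding N_def by (intro linear_subspace_image M f.linear)
  define F where "F k = closure (f ` (M \<inter> ball 0 (real (Suc k))))" for k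
  have FN: "F k \<subseteq> N" for k
    unfolding F_def N_def by (rule closure_minimal[OF _ cl]) auto
  have UF: "\<Union> (range F) = N"
  proof
    show "N \<subseteq> \<Union> (range F)"
    proof
      fix y assume "y \<in> N"
      then obtain x where x: "x \<in> M" "y = f x" by (auto simp: N_def)
      obtain k where "norm x \<le> real k" using real_arch_simple by blast
      then have "y \<in> f ` (M \<inter> ball 0 (real (Suc k)))" using x by auto
      then have "y \<in> F k" unfolding F_def by (rule subsetD[OF closure_subset])
      then show "y \<in> \<Union> (range F)" by blast
    qed
  qed (use FN in blast)
  have "\<exists>k. top_of_set N interior_of F k \<noteq> {}"
  proof (rule ccontr)
    assume "\<not> (\<exists>k. top_of_set N interior_of F k \<noteq> {})"
    then have empty: "top_of_set N interior_of F k = {}" for k by blast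
    have "top_of_set N interior_of \<Union> (range F) = {}"
    proof (rule Baire_category_alt)
      have "completely_metrizable_space (top_of_set N)"
        using cl by (intro completely_metrizable_space_closedin completely_metrizable_space_euclidean)
          (simp add: N_def)
      then show "completely_metrizable_space (top_of_set N) \<or>
        locally_compact_space (top_of_set N) \<and> regular_space (top_of_set N)" ..
      show "closedin (top_of_set N) T \<and> top_of_set N interior_of T = {}" if "T \<in> range F" for T
      proof -
        from that obtain k where k: "T = F k" by blast
        have "closedin (top_of_set N) (F k)" by (rule closed_subset[OF FN]) (simp add: F_def)
        then show ?thesis using empty k by simp
      qed
    qed simp
    moreover have "top_of_set N interior_of N = N"
      using interior_of_topspace[of "top_of_set N"] by simp
    ultimately show False using subspace_0[OF N] by (simp add: UF)
  qed
  then obtain k y0 where "y0 \<in> top_of_set N interior_of F k" by blast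
  then obtain T where T: "openin (top_of_set N) T" "y0 \<in> T" "T \<subseteq> F k"
    by (auto simp: interior_of_def)
  then obtain r where r: "0 < r" "ball y0 r \<inter> N \<subseteq> F k" and y0: "y0 \<in> N"
    unfolding openin_contains_ball by blast
  define K where "K = real (Suc k)"
  \<comment> \<open>For t = r / (2 norm y), the point y0 + t y is at distance r/2 from y0 and stays
    in \<open>F k\<close>. Approximating it and y0 within r/8 by images of x1 and x2 gives norm (x1
    - x2) at most 2 K and an error of at most r/4. Division by t turns these into D norm y and norm
    y / 2.\<close>
  define D where "D = 4 * K / r"
  have K: "0 < K" by (simp add: K_def)
  have F_approx: "\<exists>x\<in>M. norm x < K \<and> norm (y - f x) < e" if "y \<in> F k" "0 < e" for y e
  proof -
    from that obtain z where "z \<in> f ` (M \<inter> ball 0 K)" "dist z y < e"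
      unfolding F_def closure_approachable K_def by blast
    then show ?thesis by (auto simp: dist_norm norm_minus_commute)
  qed
  have approx: "\<exists>x\<in>M. norm x \<le> D * norm y \<and> norm (y - f x) \<le> norm y / 2" if y: "y \<in> N" for y
  proof (cases "y = 0")
    case True
    then show ?thesis using subspace_0[OF M(1)] by (intro bexI[of _ 0]) (auto simp: f.zero)
  next
    case False
    define t where "t = r / (2 * norm y)"
    have t: "0 < t" and r8: "0 < r / 8" using r False by (simp_all add: t_def)
    have "y0 + t *\<^sub>R y \<in> F k"
      using r y0 y N False by (intro subsetD[OF r(2)])
        (auto simp: dist_norm t_def subspace_add subspace_scale)
    then obtain x1 where x1: "x1 \<in> M" "norm x1 < K" "norm (y0 + t *\<^sub>R y - f x1) < r / 8"
      using F_approx[OF _ r8] by blast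
    have "y0 \<in> F k" using T by auto
    then obtain x2 where x2: "x2 \<in> M" "norm x2 < K" "norm (y0 - f x2) < r / 8"
      using F_approx[OF _ r8] by blast
    define x where "x = inverse t *\<^sub>R (x1 - x2)"
    have "x \<in> M" using x1 x2 M by (simp add: x_def subspace_scale subspace_diff)
    moreover have "norm x \<le> D * norm y"
    proof -
      have "norm x = inverse t * norm (x1 - x2)" using t by (simp add: x_def)
      also have "\<dots> \<le> inverse t * (2 * K)"
        using t x1 x2 norm_triangle_ineq4[of x1 x2] by (intro mult_left_mono) auto
      also have "\<dots> = D * norm y" by (simp add: t_def D_def)
      finally show ?thesis .
    qed
    moreover have "norm (y - f x) \<le> norm y / 2"
    proof -
      have "y - f x = inverse t *\<^sub>R ((y0 + t *\<^sub>R y - f x1) - (y0 - f x2))"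
        using t by (simp add: x_def f.scaleR f.diff algebra_simps)
      then have "norm (y - f x) = inverse t * norm ((y0 + t *\<^sub>R y - f x1) - (y0 - f x2))"
        using t by simp
      also have "\<dots> \<le> inverse t * (r / 4)"
        using t x1 x2 norm_triangle_ineq4[of "y0 + t *\<^sub>R y - f x1" "y0 - f x2"]
        by (intro mult_left_mono) auto
      also have "\<dots> = norm y / 2" using r by (simp add: t_def)
      finally show ?thesis .
    qed
    ultimately show ?thesis by blast
  qed
  have "\<exists>x\<in>M. f x = y \<and> norm x \<le> 2 * D * norm y" if "y \<in> N" for y
  proof (rule exact_preimage_if_approximate[OF f M _ approx that])
    show "y - f x \<in> N" if "x \<in> M" "y \<in> N" for x y
      using that N by (auto simp: N_def intro: subspace_diff)
  qed
  moreover have "0 < 2 * D" using K r by (simp add: D_def)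
  ultimately show ?thesis unfolding N_def by blast
qed

text \<open>The iteration is run on the closure of the image. A point y of the closure lies within
  norm y / 2 of some f u, whose norm is then at most 2 norm y; replacing u by its controlled
  preimage gives an approximate solution for y, and hence an exact one.\<close>

lemma closed_image_if_bounded_preimages:
  fixes f :: "'a :: banach \<Rightarrow> 'b :: real_normed_vector"
  assumes f: "bounded_linear f" and M: "subspace M" "closed M"
    and C: "0 < C" "\<And>x. x \<in> M \<Longrightarrow> \<exists>x'\<in>M. f x' = f x \<and> norm x' \<le> C * norm (f x)"
  shows "closed (f ` M)"
proof -
  interpret f: bounded_linear f by fact
  have sub: "subspace (f ` M)" by (intro linear_subspace_image M f.linear)
  have "\<exists>x\<in>M. f x = y \<and> norm x \<le> 2 * (2 * C) * norm y" if "y \<in> closure (f ` M)" for y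
  proof (rule exact_preimage_if_approximate[OF f M _ _ that])
    fix x y assume x: "x \<in> M" and y: "y \<in> closure (f ` M)"
    show "y - f x \<in> closure (f ` M)"
      unfolding closure_approachable
    proof (intro allI impI)
      fix e :: real assume "0 < e"
      then obtain z where "z \<in> f ` M" "dist z y < e" using y closure_approachable by blast
      then show "\<exists>z\<in>f ` M. dist z (y - f x) < e"
        using x sub by (intro bexI[of _ "z - f x"]) (auto intro!: subspace_diff simp: dist_norm)
    qed
  next
    fix y assume y: "y \<in> closure (f ` M)"
    show "\<exists>x\<in>M. norm x \<le> 2 * C * norm y \<and> norm (y - f x) \<le> norm y / 2"
    proof (cases "y = 0")
      case True
      then show ?thesis using subspace_0[OF M(1)] by (intro bexI[of _ 0]) (auto simp: f.zero)
    next
      case False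
      then have "0 < norm y / 2" by simp
      with y obtain u where u: "u \<in> M" "dist (f u) y < norm y / 2"
        unfolding closure_approachable by blast
      obtain x where x: "x \<in> M" "f x = f u" "norm x \<le> C * norm (f u)" using C(2)[OF u(1)] by blast
      have *: "norm (y - f x) < norm y / 2" using u x by (simp add: dist_norm norm_minus_commute)
      have "norm (f u) \<le> 2 * norm y"
        using * x norm_triangle_ineq2[of "f x" y] norm_ge_zero[of y]
        by (simp add: norm_minus_commute del: norm_ge_zero)
      then have "C * norm (f u) \<le> C * (2 * norm y)" using C(1) by (intro mult_left_mono) auto
      then show ?thesis using x * by (intro bexI[of _ x]) auto
    qed
  qed
  then have "closure (f ` M) \<subseteq> f ` M" by blast
  then show ?thesis using closure_subset_eq by blast
qed

text \<open>The definition by kernel and range is unstable under perturbation; the estimate is not.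
  Everything below about \<open>sigma_a\<close> is derived from the estimate.\<close>

lemma bounded_below_iff:
  fixes T :: "'a :: cbanach \<Rightarrow>\<^sub>\<complex> 'a"
  shows "bounded_below T \<longleftrightarrow> (\<exists>c>0. \<forall>x. c * norm x \<le> norm (cblinfun_apply T x))"
proof
  interpret T: bounded_linear "cblinfun_apply T" by (rule bounded_linear_cblinfun_apply)
  assume b: "bounded_below T"
  then have "closed (range (cblinfun_apply T))" by (simp add: bounded_below_def range_on_def)
  then obtain C where C: "0 < C"
    "\<And>y. y \<in> range (cblinfun_apply T) \<Longrightarrow> \<exists>x. cblinfun_apply T x = y \<and> norm x \<le> C * norm y"
    using bounded_preimages_if_closed_image[OF T.bounded_linear_axioms subspace_UNIV closed_UNIV]
    by blast
  have "inverse C * norm x \<le> norm (cblinfun_apply T x)" for x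
  proof -
    obtain x' where x': "cblinfun_apply T x' = cblinfun_apply T x" "norm x' \<le> C * norm (cblinfun_apply T x)"
      using C(2) by blast
    then have "x' - x \<in> null_space T" by (simp add: null_space_on_def T.diff)
    then have "x' = x" using b by (simp add: bounded_below_def)
    then show ?thesis using x' C(1) by (simp add: field_simps)
  qed
  then show "\<exists>c>0. \<forall>x. c * norm x \<le> norm (cblinfun_apply T x)" using C(1) by (metis positive_imp_inverse_positive)
next
  interpret T: bounded_linear "cblinfun_apply T" by (rule bounded_linear_cblinfun_apply)
  assume "\<exists>c>0. \<forall>x. c * norm x \<le> norm (cblinfun_apply T x)"
  then obtain c where c: "0 < c" "\<And>x. c * norm x \<le> norm (cblinfun_apply T x)" by blast
  have "x = 0" if "cblinfun_apply T x = 0" for x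
    using c(1) c(2)[of x] that by (simp add: mult_le_0_iff)
  then have "null_space T = {0}" by (auto simp: null_space_on_def T.zero)
  moreover have "norm x \<le> inverse c * norm (cblinfun_apply T x)" for x
    using c(1) c(2)[of x] by (simp add: field_simps)
  then have "closed (range (cblinfun_apply T))"
    using c(1) by (intro closed_image_if_bounded_preimages[where C = "inverse c"])
      (auto intro: T.bounded_linear_axioms)
  ultimately show "bounded_below T" by (simp add: bounded_below_def range_on_def)
qed

text \<open>If v is outside W, its positive distance d to W controls the coefficient: d |c| is at
  most the norm of w + c v. The coefficients of a convergent sequence are therefore Cauchy, and the
  W-components converge as well.\<close>

lemma closed_plus_span_insert:
  fixes W :: "'a :: cbanach set"
  assumes W: "complex_vector.subspace W" "closed W"
  shows "closed {w + c *\<^sub>C v | w c. w \<in> W}"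
proof (cases "v \<in> W")
  case True
  have "{w + c *\<^sub>C v | w c. w \<in> W} = W"
  proof (intro equalityI subsetI)
    fix x assume "x \<in> W"
    then have "x = x + 0 *\<^sub>C v \<and> x \<in> W" by simp
    then show "x \<in> {w + c *\<^sub>C v | w c. w \<in> W}" by blast
  qed (use True W(1) in \<open>auto intro: complex_vector.subspace_add complex_vector.subspace_scale\<close>)
  then show ?thesis using W(2) by simp
next
  case False
  then obtain d where d: "0 < d" "\<And>w. w \<in> W \<Longrightarrow> d \<le> dist v w"
    using W(2) closed_approachable[of W v] by (metis dist_commute not_le)
  have low: "d * cmod c \<le> norm (w + c *\<^sub>C v)" if "w \<in> W" for w c
  proof (cases "c = 0")
    case c: False
    have "- (inverse c *\<^sub>C w) \<in> W"
      using W(1) that by (intro complex_vector.subspace_neg complex_vector.subspace_scale)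
    from d(2)[OF this] have "d \<le> norm (inverse c *\<^sub>C (w + c *\<^sub>C v))"
      using c by (simp add: dist_norm scaleC_add_right scaleC_scaleC add.commute)
    then have "cmod c * d \<le> cmod c * norm (inverse c *\<^sub>C (w + c *\<^sub>C v))"
      by (intro mult_left_mono) auto
    also have "\<dots> = norm (w + c *\<^sub>C v)"
      using c by (simp only: norm_scaleC norm_inverse) simp
    finally show ?thesis by (simp add: mult.commute)
  qed simp
  show ?thesis
    unfolding closed_sequential_limits
  proof (intro allI impI, elim conjE)
    fix y l assume "\<forall>n :: nat. y n \<in> {w + c *\<^sub>C v | w c. w \<in> W}" and l: "y \<longlonglongrightarrow> l"
    then obtain w c where wc: "\<And>n. y n = w n + c n *\<^sub>C v" "\<And>n. w n \<in> W" by simp metis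
    have "Cauchy c"
    proof (rule CauchyI)
      fix e :: real assume e: "0 < e"
      then have "0 < d * e" using d(1) by simp
      then obtain N where N: "\<And>m n. m \<ge> N \<Longrightarrow> n \<ge> N \<Longrightarrow> norm (y m - y n) < d * e"
        using CauchyD[OF LIMSEQ_imp_Cauchy[OF l]] by blast
      have "norm (c m - c n) < e" if "m \<ge> N" "n \<ge> N" for m n
      proof -
        have "y m - y n = (w m - w n) + (c m - c n) *\<^sub>C v"
          by (simp add: wc(1) complex_vector.scale_left_diff_distrib algebra_simps)
        moreover have "w m - w n \<in> W" using W(1) wc(2) by (intro complex_vector.subspace_diff)
        ultimately have "d * cmod (c m - c n) < d * e"
          using low[of "w m - w n" "c m - c n"] N[OF that] by simp
        then show ?thesis using d(1) by simp
      qed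
      then show "\<exists>M. \<forall>m\<ge>M. \<forall>n\<ge>M. norm (c m - c n) < e" by blast
    qed
    then obtain c' where c': "c \<longlonglongrightarrow> c'" using Cauchy_convergent convergent_def by blast
    have "bounded_linear (\<lambda>c. c *\<^sub>C v)"
      by (rule bounded_linear_intro[where K = "norm v"])
        (auto simp: scaleC_add_left scaleR_scaleC scaleC_scaleC norm_scaleC scaleC_complex_def)
    from bounded_linear.tendsto[OF this c'] have "(\<lambda>n. y n - c n *\<^sub>C v) \<longlonglongrightarrow> l - c' *\<^sub>C v"
      by (intro tendsto_diff l)
    then have "w \<longlonglongrightarrow> l - c' *\<^sub>C v" by (simp add: wc(1))
    then have "l - c' *\<^sub>C v \<in> W" using W(2) wc(2) closed_sequentially by blast
    then show "l \<in> {w + c *\<^sub>C v | w c. w \<in> W}" by (auto intro!: exI[of _ "l - c' *\<^sub>C v"] exI[of _ c'])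
  qed
qed

lemma closed_plus_span:
  fixes W :: "'a :: cbanach set"
  assumes "finite S" and "complex_vector.subspace W" "closed W"
  shows "closed {w + x | w x. w \<in> W \<and> x \<in> complex_vector.span S}"
  using assms
proof (induction S arbitrary: W rule: finite_induct)
  case empty
  then show ?case by simp
next
  case (insert v S)
  define W' where "W' = {w + c *\<^sub>C v | w c. w \<in> W}"
  have "closed W'" unfolding W'_def by (intro closed_plus_span_insert insert.prems)
  moreover have "complex_vector.subspace W'"
  proof (rule complex_vector.subspaceI)
    have "(0 :: 'a) = 0 + 0 *\<^sub>C v" by simp
    then show "0 \<in> W'" unfolding W'_def using complex_vector.subspace_0[OF insert.prems(1)] by blast
  next
    fix x y assume "x \<in> W'" "y \<in> W'"
    then obtain w c w' c' where *: "x = w + c *\<^sub>C v" "y = w' + c' *\<^sub>C v" "w \<in> W" "w' \<in> W"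
      unfolding W'_def by blast
    have "x + y = (w + w') + (c + c') *\<^sub>C v" by (simp add: * scaleC_add_left algebra_simps)
    then show "x + y \<in> W'"
      unfolding W'_def using * complex_vector.subspace_add[OF insert.prems(1)] by blast
  next
    fix c' x assume "x \<in> W'"
    then obtain w c where *: "x = w + c *\<^sub>C v" "w \<in> W" unfolding W'_def by blast
    have "c' *\<^sub>C x = c' *\<^sub>C w + (c' * c) *\<^sub>C v" by (simp add: * scaleC_add_right scaleC_scaleC)
    then show "c' *\<^sub>C x \<in> W'"
      unfolding W'_def using * complex_vector.subspace_scale[OF insert.prems(1)] by blast
  qed
  ultimately have "closed {w + x | w x. w \<in> W' \<and> x \<in> complex_vector.span S}"
    by (intro insert.IH)
  also have "{w + x | w x. w \<in> W' \<and> x \<in> complex_vector.span S} =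
      {w + x | w x. w \<in> W \<and> x \<in> complex_vector.span (insert v S)}"
  proof (intro equalityI subsetI)
    fix z assume "z \<in> {w + x | w x. w \<in> W' \<and> x \<in> complex_vector.span S}"
    then obtain w c x where *: "z = w + c *\<^sub>C v + x" "w \<in> W" "x \<in> complex_vector.span S"
      unfolding W'_def by blast
    have "c *\<^sub>C v + x \<in> complex_vector.span (insert v S)"
      using *(3) complex_vector.span_mono[of S "insert v S"]
      by (intro complex_vector.span_add complex_vector.span_scale) (auto intro: complex_vector.span_base)
    then show "z \<in> {w + x | w x. w \<in> W \<and> x \<in> complex_vector.span (insert v S)}"
      using * by (auto simp: add.assoc)
  next
    fix z assume "z \<in> {w + x | w x. w \<in> W \<and> x \<in> complex_vector.span (insert v S)}"
    then obtain w x where *: "z = w + x" "w \<in> W" "x \<in> complex_vector.span (insert v S)" by blast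
    then obtain c where c: "x - c *\<^sub>C v \<in> complex_vector.span S"
      using complex_vector.span_breakdown_eq by blast
    have "z = (w + c *\<^sub>C v) + (x - c *\<^sub>C v)" using * by simp
    then show "z \<in> {w + x | w x. w \<in> W' \<and> x \<in> complex_vector.span S}"
      unfolding W'_def using c *(2) by blast
  qed
  finally show ?case .
qed

lemma fin_dim_basis:
  assumes "fin_dim V" "complex_vector.subspace V"
  obtains B where "finite B" "complex_vector.independent B" "complex_vector.span B = V"
    "card B = complex_vector.dim V"
proof -
  obtain B where B: "B \<subseteq> V" "complex_vector.independent B" "V \<subseteq> complex_vector.span B"
      "card B = complex_vector.dim V"
    by (rule complex_vector.basis_exists)
  from assms(1) obtain S where "finite S" "V \<subseteq> complex_vector.span S" by (auto simp: fin_dim_def)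
  then have "finite B" using B complex_vector.independent_span_bound[of S B] by blast
  moreover have "complex_vector.span B = V"
    using B assms(2) by (simp add: complex_vector.span_subspace)
  ultimately show ?thesis using that B by blast
qed

lemma subspace_eq_if_dim_ge:
  assumes V: "complex_vector.subspace V" and U: "complex_vector.subspace U" "fin_dim U"
    and "V \<subseteq> U" and dim: "complex_vector.dim U \<le> complex_vector.dim V"
  shows "V = U"
proof -
  have "fin_dim V" using assms(4) U(2) unfolding fin_dim_def by blast
  then obtain B where B: "finite B" "complex_vector.independent B" "complex_vector.span B = V"
      "card B = complex_vector.dim V"
    using V by (rule fin_dim_basis)
  have "B \<subseteq> U" using B(3) assms(4) complex_vector.span_superset by blast
  then obtain D where D: "B \<subseteq> D" "D \<subseteq> U" "complex_vector.independent D" "U \<subseteq> complex_vector.span D"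
    using complex_vector.maximal_independent_subset_extend[of B U] B(2) by blast
  from U(2) obtain S where "finite S" "U \<subseteq> complex_vector.span S" by (auto simp: fin_dim_def)
  then have "finite D" using D complex_vector.independent_span_bound[of S D] by blast
  moreover have "card D = complex_vector.dim U"
    using complex_vector.basis_card_eq_dim[OF D(2,4,3)] .
  ultimately have "B = D" using B(4) dim D(1) by (simp add: card_seteq)
  then show ?thesis using B(3) D(4) assms(4) by blast
qed

text \<open>The point is that W plus the finite-dimensional kernel of T on M is closed. A limit of T
  (w n) is T x with x in M; bounded lifts z n of the differences tend to 0, and x + z n differs from
  w n by a kernel vector. So x lies in W plus the kernel. This propagates closedness along the
  ranges of the powers of T.\<close>

lemma closed_image_of_closed_subspace:
  fixes T :: "'a :: cbanach \<Rightarrow>\<^sub>\<complex> 'a"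
  assumes M: "complex_vector.subspace M" "closed M" "closed (cblinfun_apply T ` M)"
    and fin: "fin_dim (null_space_on M T)"
    and W: "complex_vector.subspace W" "closed W" "W \<subseteq> M"
  shows "closed (cblinfun_apply T ` W)"
proof -
  interpret T: bounded_linear "cblinfun_apply T" by (rule bounded_linear_cblinfun_apply)
  have N: "complex_vector.subspace (null_space_on M T)"
    using M(1) by (auto simp: complex_vector.subspace_def null_space_on_def T.zero T.add cblinfun_apply_scaleC)
  obtain B where B: "finite B" "complex_vector.span B = null_space_on M T"
    using fin_dim_basis[OF fin N] by metis
  define V where "V = {w + x | w x. w \<in> W \<and> x \<in> null_space_on M T}"
  have clV: "closed V" using closed_plus_span[OF B(1) W(1,2)] by (simp add: V_def B(2))
  obtain C where C: "0 < C" "\<And>y. y \<in> cblinfun_apply T ` M \<Longrightarrow> \<exists>x\<in>M. cblinfun_apply T x = y \<and> norm x \<le> C * norm y"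
    using bounded_preimages_if_closed_image[OF T.bounded_linear_axioms complex_subspace_imp_subspace[OF M(1)] M(2,3)]
    by blast
  show ?thesis
    unfolding closed_sequential_limits
  proof (intro allI impI, elim conjE)
    fix y l assume y: "\<forall>n :: nat. y n \<in> cblinfun_apply T ` W" and l: "y \<longlonglongrightarrow> l"
    then have "\<forall>n. \<exists>x. y n = cblinfun_apply T x \<and> x \<in> W" by blast
    then obtain w where w: "\<And>n. y n = cblinfun_apply T (w n)" "\<And>n. w n \<in> W" by metis
    have "l \<in> cblinfun_apply T ` M"
      by (rule closed_sequentially[OF M(3) _ l]) (use y W(3) in blast)
    then obtain x where x: "x \<in> M" "l = cblinfun_apply T x" by blast
    have "\<exists>z\<in>M. cblinfun_apply T z = y n - l \<and> norm z \<le> C * norm (y n - l)" for n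
    proof (rule C(2), rule image_eqI)
      show "y n - l = cblinfun_apply T (w n - x)" by (simp only: w(1) x(2) T.diff)
      show "w n - x \<in> M"
        using w(2) W(3) x(1) by (intro complex_vector.subspace_diff[OF M(1)]) auto
    qed
    then obtain z where z: "\<And>n. z n \<in> M" "\<And>n. cblinfun_apply T (z n) = y n - l"
      "\<And>n. norm (z n) \<le> C * norm (y n - l)" by metis
    have "(\<lambda>n. C * norm (y n - l)) \<longlonglongrightarrow> 0"
      using l by (intro tendsto_mult_right_zero) (simp add: LIM_zero tendsto_norm_zero)
    then have z0: "z \<longlonglongrightarrow> 0" by (rule Lim_null_comparison[rotated]) (simp add: z(3))
    have "x + z n \<in> V" for n
    proof -
      have "x + z n - w n \<in> null_space_on M T"
      proof -
        have "x + z n - w n \<in> M"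
          using x(1) z(1) w(2) W(3) complex_vector.subspace_add[OF M(1)]
            complex_vector.subspace_diff[OF M(1)] by blast
        then show ?thesis by (simp add: null_space_on_def T.add T.diff z(2) x(2) flip: w(1))
      qed
      moreover have "x + z n = w n + (x + z n - w n)" by simp
      ultimately show ?thesis unfolding V_def using w(2) by blast
    qed
    moreover have "(\<lambda>n. x + z n) \<longlonglongrightarrow> x + 0" by (intro tendsto_intros z0)
    ultimately have "x \<in> V" using closed_sequentially[OF clV, of "\<lambda>n. x + z n" x] by simp
    then show "l \<in> cblinfun_apply T ` W"
      using x by (auto simp: V_def null_space_on_def T.add)
  qed
qed

section \<open>Semi B-Fredholm operators and finite ascent\<close>

lemma cblinfun_power_apply: "cblinfun_apply (T ^\<^sub>C n) = cblinfun_apply T ^^ n"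
  by (induction n) (auto simp: cblinfun_id.rep_eq cblinfun_compose.rep_eq fun_eq_iff)

lemma op_range_power_Suc: "op_range (T ^\<^sub>C Suc n) = cblinfun_apply T ` op_range (T ^\<^sub>C n)"
  unfolding range_on_def cblinfun_power_apply by auto

lemma op_range_power_antimono: "m \<le> n \<Longrightarrow> op_range (T ^\<^sub>C n) \<subseteq> op_range (T ^\<^sub>C m)"
  by (auto simp: range_on_def cblinfun_power_apply funpow_add le_iff_add)

lemma subspace_op_range: "complex_vector.subspace (op_range T)"
proof -
  interpret T: bounded_linear "cblinfun_apply T" by (rule bounded_linear_cblinfun_apply)
  show ?thesis
    by (auto simp: complex_vector.subspace_def range_on_def image_iff simp flip: T.add cblinfun_apply_scaleC
        intro: exI[of _ 0] simp: T.zero)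
qed

lemma subspace_null_space_on:
  assumes "complex_vector.subspace M"
  shows "complex_vector.subspace (null_space_on M T)"
proof -
  interpret T: bounded_linear "cblinfun_apply T" by (rule bounded_linear_cblinfun_apply)
  show ?thesis
    using assms
    by (auto simp: complex_vector.subspace_def null_space_on_def T.zero T.add cblinfun_apply_scaleC)
qed

text \<open>T shifts the backward orbit and kills its first term, so the power series with terms l^n
  z n is an eigenvector for l wherever it converges. With r = |l| C < 1/2 the tail has norm at most
  r / (1 - r) times norm (z 0), hence less than norm (z 0), and the sum cannot vanish.\<close>

lemma eigenvector_if_bounded_backward_orbit:
  fixes T :: "'a :: cbanach \<Rightarrow>\<^sub>\<complex> 'a"
  assumes z0: "cblinfun_apply T (z 0) = 0" "z 0 \<noteq> 0"
    and zS: "\<And>n. cblinfun_apply T (z (Suc n)) = z n"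
    and bd: "\<And>n. norm (z (Suc n)) \<le> C * norm (z n)" and C: "0 < C"
    and l: "cmod l * C < 1 / 2"
  shows "\<exists>x. x \<noteq> 0 \<and> cblinfun_apply T x = l *\<^sub>C x"
proof -
  interpret T: bounded_linear "cblinfun_apply T" by (rule bounded_linear_cblinfun_apply)
  define r where "r = cmod l * C"
  have r: "0 \<le> r" "r < 1 / 2" using C l by (auto simp: r_def)
  have zn: "norm (z n) \<le> C ^ n * norm (z 0)" for n
  proof (induction n)
    case (Suc n)
    have "C * norm (z n) \<le> C * (C ^ n * norm (z 0))" using Suc C by (intro mult_left_mono) auto
    then show ?case using bd[of n] by simp
  qed simp
  have n: "norm (l ^ n *\<^sub>C z n) \<le> r ^ n * norm (z 0)" for n
    using mult_left_mono[OF zn[of n], of "cmod l ^ n"]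
    by (simp add: norm_scaleC norm_power r_def power_mult_distrib mult.assoc)
  have sg: "summable (\<lambda>n. r ^ n * norm (z 0))"
    using r by (intro summable_mult2 summable_geometric) auto
  have sn: "summable (\<lambda>n. norm (l ^ n *\<^sub>C z n))"
    by (rule summable_comparison_test[OF _ sg]) (use n in auto)
  then have s: "summable (\<lambda>n. l ^ n *\<^sub>C z n)" by (rule summable_norm_cancel)
  define x where "x = (\<Sum>n. l ^ n *\<^sub>C z n)"
  have x: "x = z 0 + (\<Sum>n. l ^ Suc n *\<^sub>C z (Suc n))"
    using suminf_split_head[OF s] by (simp add: x_def scaleC_one)
  have "cblinfun_apply T x = (\<Sum>n. cblinfun_apply T (l ^ n *\<^sub>C z n))"
    unfolding x_def by (rule T.suminf[OF s])
  also have "\<dots> = (\<Sum>n. cblinfun_apply T (l ^ Suc n *\<^sub>C z (Suc n)))"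
    using suminf_split_head[OF T.summable[OF s]] by (simp add: z0 cblinfun_apply_scaleC)
  also have "\<dots> = (\<Sum>n. l *\<^sub>C l ^ n *\<^sub>C z n)"
    by (simp add: cblinfun_apply_scaleC zS scaleC_scaleC)
  also have "\<dots> = l *\<^sub>C x"
    unfolding x_def by (rule bounded_linear.suminf[OF bounded_linear_scaleC_right s, symmetric])
  finally have eig: "cblinfun_apply T x = l *\<^sub>C x" .
  have "x \<noteq> 0"
  proof
    assume "x = 0"
    then have "norm (z 0) = norm (\<Sum>n. l ^ Suc n *\<^sub>C z (Suc n))"
      unfolding x by (metis add_eq_0_iff norm_minus_cancel)
    also have "\<dots> \<le> (\<Sum>n. norm (l ^ Suc n *\<^sub>C z (Suc n)))"
      using sn by (intro summable_norm) (subst summable_Suc_iff)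
    also have "\<dots> \<le> (\<Sum>n. r ^ Suc n * norm (z 0))"
      using sn sg by (intro suminf_le n) (subst summable_Suc_iff, simp)+
    also have "\<dots> = r / (1 - r) * norm (z 0)"
    proof -
      have "(\<Sum>n. r ^ Suc n * norm (z 0)) = (\<Sum>n. r ^ n * (r * norm (z 0)))" by (simp add: ac_simps)
      also have "\<dots> = (\<Sum>n. r ^ n) * (r * norm (z 0))"
        using r by (intro suminf_mult2[symmetric] summable_geometric) auto
      finally show ?thesis using r by (simp add: suminf_geometric)
    qed
    also have "\<dots> < 1 * norm (z 0)"
      using r z0(2) by (intro mult_strict_right_mono) auto
    finally show False by simp
  qed
  with eig show ?thesis by blast
qed

section \<open>Stabilization of kernels and closedness of ranges of powers\<close>

lemma edim_finite_iff: "edim V < \<infinity> \<longleftrightarrow> fin_dim V"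
  by (simp add: edim_def)

lemma decreasing_subspaces_stabilize:
  fixes V :: "nat \<Rightarrow> 'a :: complex_normed_vector set"
  assumes "\<And>m. complex_vector.subspace (V m)" "\<And>m k. m \<le> k \<Longrightarrow> V k \<subseteq> V m" "fin_dim (V 0)"
  obtains m0 where "\<And>m. m0 \<le> m \<Longrightarrow> V m = V m0"
proof -
  obtain m0 where m0: "\<And>m. complex_vector.dim (V m0) \<le> complex_vector.dim (V m)"
    using ex_has_least_nat[of "\<lambda>_. True" _ "\<lambda>m. complex_vector.dim (V m)"] by auto
  have "fin_dim (V m)" for m
    using assms(2)[of 0 m] assms(3) unfolding fin_dim_def by blast
  then have "V m = V m0" if "m0 \<le> m" for m
    using that m0 assms by (intro subspace_eq_if_dim_ge) auto
  then show ?thesis by (rule that)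
qed

lemma null_space_powers_stable:
  assumes "null_space (T ^\<^sub>C a) = null_space (T ^\<^sub>C Suc a)" "a \<le> m"
  shows "null_space (T ^\<^sub>C m) = null_space (T ^\<^sub>C a)"
proof -
  have "null_space (T ^\<^sub>C (a + k)) = null_space (T ^\<^sub>C a)" for k
  proof (induction k)
    case (Suc k)
    have "cblinfun_apply (T ^\<^sub>C (a + Suc k)) x = 0 \<longleftrightarrow> cblinfun_apply (T ^\<^sub>C (a + k)) (cblinfun_apply T x) = 0" for x
      by (simp add: cblinfun_power_apply funpow_swap1 del: cblinfun_power.simps)
    also have "\<dots> x \<longleftrightarrow> cblinfun_apply (T ^\<^sub>C a) (cblinfun_apply T x) = 0" for x
      using Suc by (auto simp: null_space_on_def set_eq_iff)
    also have "\<dots> x \<longleftrightarrow> cblinfun_apply (T ^\<^sub>C Suc a) x = 0" for x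
      by (simp add: cblinfun_power_apply funpow_swap1 del: cblinfun_power.simps)
    also have "\<dots> x \<longleftrightarrow> cblinfun_apply (T ^\<^sub>C a) x = 0" for x
      using assms(1) by (auto simp: null_space_on_def set_eq_iff)
    finally show ?case by (auto simp: null_space_on_def)
  qed simp
  then show ?thesis using assms(2) le_Suc_ex by metis
qed

text \<open>Equal kernels make a controlled preimage under the (j + i)-th power a preimage under the
  j-th one as well, and the norm of T^i absorbs the change in the bound. This descends from a large
  power to the exponent that \<open>Pi_a\<close> prescribes. The added 1 in D keeps it positive when
  T^i = 0.\<close>

lemma closed_op_range_power_if_null_space_eq:
  fixes T :: "'a :: cbanach \<Rightarrow>\<^sub>\<complex> 'a"
  assumes cl: "closed (op_range (T ^\<^sub>C (j + i)))"
    and null: "null_space (T ^\<^sub>C (j + i)) = null_space (T ^\<^sub>C j)"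
  shows "closed (op_range (T ^\<^sub>C j))"
proof -
  have bl: "bounded_linear (cblinfun_apply S)" for S :: "'a \<Rightarrow>\<^sub>\<complex> 'a" by (rule bounded_linear_cblinfun_apply)
  have cl': "closed (cblinfun_apply (T ^\<^sub>C (j + i)) ` UNIV)" using cl by (simp add: range_on_def)
  obtain C where C: "0 < C" "\<And>x. \<exists>x'. cblinfun_apply (T ^\<^sub>C (j + i)) x' = cblinfun_apply (T ^\<^sub>C (j + i)) x \<and>
      norm x' \<le> C * norm (cblinfun_apply (T ^\<^sub>C (j + i)) x)"
    using bounded_preimages_if_closed_image[OF bl subspace_UNIV closed_UNIV cl'] by blast
  define D where "D = C * (norm (T ^\<^sub>C i) + 1)"
  have "0 < D" using C(1) by (simp add: D_def add_nonneg_pos)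
  moreover have "\<exists>x'\<in>UNIV. cblinfun_apply (T ^\<^sub>C j) x' = cblinfun_apply (T ^\<^sub>C j) x \<and>
      norm x' \<le> D * norm (cblinfun_apply (T ^\<^sub>C j) x)" for x
  proof -
    obtain x' where x': "cblinfun_apply (T ^\<^sub>C (j + i)) x' = cblinfun_apply (T ^\<^sub>C (j + i)) x"
      "norm x' \<le> C * norm (cblinfun_apply (T ^\<^sub>C (j + i)) x)" using C(2) by blast
    have "x' - x \<in> null_space (T ^\<^sub>C (j + i))"
      using x'(1) by (simp add: null_space_on_def linear_diff[OF bounded_linear.linear[OF bl]])
    then have "cblinfun_apply (T ^\<^sub>C j) x' = cblinfun_apply (T ^\<^sub>C j) x"
      unfolding null by (simp add: null_space_on_def linear_diff[OF bounded_linear.linear[OF bl]])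
    moreover have "norm x' \<le> D * norm (cblinfun_apply (T ^\<^sub>C j) x)"
    proof -
      have "cblinfun_apply (T ^\<^sub>C (j + i)) x = cblinfun_apply (T ^\<^sub>C i) (cblinfun_apply (T ^\<^sub>C j) x)"
        by (simp add: cblinfun_power_apply add.commute[of j] funpow_add)
      then have "norm (cblinfun_apply (T ^\<^sub>C (j + i)) x) \<le> (norm (T ^\<^sub>C i) + 1) * norm (cblinfun_apply (T ^\<^sub>C j) x)"
        using norm_cblinfun_apply[of "T ^\<^sub>C i" "cblinfun_apply (T ^\<^sub>C j) x"]
        by (simp add: distrib_right add_increasing2)
      then have "C * norm (cblinfun_apply (T ^\<^sub>C (j + i)) x) \<le> D * norm (cblinfun_apply (T ^\<^sub>C j) x)"
        unfolding D_def mult.assoc using C(1) by (intro mult_left_mono) auto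
      with x'(2) show ?thesis by simp
    qed
    ultimately show ?thesis by blast
  qed
  ultimately have "closed (cblinfun_apply (T ^\<^sub>C j) ` UNIV)"
    using closed_image_if_bounded_preimages[OF bl subspace_UNIV closed_UNIV, of D] by blast
  then show ?thesis by (simp add: range_on_def)
qed

text \<open>The finite-dimensional spaces \<open>N(T) \<inter> R(T^k)\<close> stabilize. A nonzero vector in all of them has a
  backward orbit of at most geometric growth, hence yields eigenvectors for all small eigenvalues.\<close>

lemma finite_ascent_if_injective_nearby:
  fixes T :: "'a :: cbanach \<Rightarrow>\<^sub>\<complex> 'a"
  assumes B: "upper_semi_b_fredholm T"
    and e: "0 < e" "\<And>l x. 0 < cmod l \<Longrightarrow> cmod l < e \<Longrightarrow> cblinfun_apply T x = l *\<^sub>C x \<Longrightarrow> x = 0"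
  shows "\<exists>a. asc T = enat a \<and> closed (op_range (T ^\<^sub>C (a + 1)))"
proof -
  interpret T: bounded_linear "cblinfun_apply T" by (rule bounded_linear_cblinfun_apply)
  define R where "R m = op_range (T ^\<^sub>C m)" for m
  from B obtain n where n: "closed (R n)" "upper_semi_fredholm_on (R n) T"
    unfolding upper_semi_b_fredholm_def semi_b_fredholm_degree_def R_def by blast
  have RS: "R (Suc m) = cblinfun_apply T ` R m" for m by (simp only: R_def op_range_power_Suc)
  have Rs: "complex_vector.subspace (R m)" for m by (simp add: R_def subspace_op_range)
  have Ranti: "R k \<subseteq> R m" if "m \<le> k" for m k using that by (simp add: R_def op_range_power_antimono)
  have fin: "fin_dim (null_space_on (R n) T)"
    using n(2) by (simp only: upper_semi_fredholm_on_def alpha_on_def edim_finite_iff)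
  have clTn: "closed (cblinfun_apply T ` R n)"
    using n by (auto simp: upper_semi_fredholm_on_def range_on_def intro: closedin_closed_trans)
  have clR: "closed (R (n + k))" for k
  proof (induction k)
    case (Suc k)
    have "closed (cblinfun_apply T ` R (n + k))"
      by (rule closed_image_of_closed_subspace[OF Rs n(1) clTn fin Rs Suc Ranti]) simp
    then show ?case by (simp add: RS)
  qed (simp add: n)
  define V where "V k = null_space_on (R (n + k)) T" for k
  have "complex_vector.subspace (V k)" for k by (simp add: V_def subspace_null_space_on Rs)
  moreover have "V k \<subseteq> V m" if "m \<le> k" for m k
    using Ranti[of "n + m" "n + k"] that by (auto simp: V_def null_space_on_def)
  moreover have "fin_dim (V 0)" using fin by (simp add: V_def)
  ultimately obtain k0 where k0: "\<And>k. k0 \<le> k \<Longrightarrow> V k = V k0"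
    using decreasing_subspaces_stabilize[of V] by metis
  define M where "M = R (n + k0)"
  have clM: "closed M" "closed (cblinfun_apply T ` M)"
    using clR[of k0] clR[of "Suc k0"] by (simp_all add: M_def RS)
  have V0: "V k0 \<subseteq> {0}"
  proof
    fix v assume v: "v \<in> V k0"
    show "v \<in> {0}"
    proof (rule ccontr)
      assume "v \<notin> {0}"
      obtain C where C: "0 < C" "\<And>y. y \<in> cblinfun_apply T ` M \<Longrightarrow> \<exists>x\<in>M. cblinfun_apply T x = y \<and> norm x \<le> C * norm y"
        using bounded_preimages_if_closed_image[OF T.bounded_linear_axioms complex_subspace_imp_subspace clM] Rs
        unfolding M_def by blast
      define I where "I = (\<Inter>k. R (n + k))"
      have vI: "v \<in> I"
      proof -
        have "v \<in> R (n + k)" for k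
        proof -
          have "V (max k k0) = V k0" by (rule k0) simp
          then have "v \<in> R (n + max k k0)" using v by (auto simp: V_def null_space_on_def)
          then show ?thesis using Ranti[of "n + k" "n + max k k0"] by auto
        qed
        then show ?thesis by (simp add: I_def)
      qed
      \<comment> \<open>T maps the intersection I onto itself, with bounded lifts. A controlled
        preimage x' in M need not lie in I a priori; but for every m it differs from a preimage in
        \<open>R (n + m)\<close> by an element of V k0, and V k0 = V m lies in that range.\<close>
      have lift: "\<exists>x'. x' \<in> I \<and> cblinfun_apply T x' = x \<and> norm x' \<le> C * norm x" if "x \<in> I" for x
      proof -
        have "x \<in> R (n + Suc k0)" using that unfolding I_def by blast
        then have "x \<in> cblinfun_apply T ` M" by (simp add: M_def RS)
        then obtain x' where x': "x' \<in> M" "cblinfun_apply T x' = x" "norm x' \<le> C * norm x"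
          using C(2) by blast
        have "x' \<in> R (n + k)" for k
        proof -
          define m where "m = max k k0"
          have "x \<in> R (n + Suc m)" using that unfolding I_def by blast
          then obtain u where u: "u \<in> R (n + m)" "x = cblinfun_apply T u" by (auto simp: RS)
          have "u \<in> M" using u(1) Ranti[of "n + k0" "n + m"] by (auto simp: M_def m_def)
          then have "x' - u \<in> V k0"
            using x' u complex_vector.subspace_diff[OF Rs, of x' "n + k0" u]
            by (simp add: V_def null_space_on_def T.diff M_def)
          then have "x' - u \<in> V m" using k0[of m] by (simp add: m_def)
          then have "x' - u + u \<in> R (n + m)"
            using u(1) by (intro complex_vector.subspace_add[OF Rs]) (simp_all add: V_def null_space_on_def)
          then show ?thesis using Ranti[of "n + k" "n + m"] by (auto simp: m_def)
        qed
        then show ?thesis using x' by (auto simp: I_def)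
      qed
      obtain g where g: "\<And>x. x \<in> I \<Longrightarrow> g x \<in> I" "\<And>x. x \<in> I \<Longrightarrow> cblinfun_apply T (g x) = x"
        "\<And>x. x \<in> I \<Longrightarrow> norm (g x) \<le> C * norm x"
        using lift by metis
      define z where "z j = (g ^^ j) v" for j
      have zI: "z j \<in> I" for j by (induction j) (auto simp: z_def vI g)
      \<comment> \<open>Below e, so that hypothesis \<open>e\<close> excludes an eigenvector; at
        most 1 / (4 C), so that |l| C stays below 1/2 and the power series produces one.\<close>
      define l where "l = complex_of_real (min (e / 2) (1 / (4 * C)))"
      have "0 < cmod l" "cmod l < e" "cmod l \<le> 1 / (4 * C)"
        using e(1) C(1) by (auto simp: l_def)
      moreover have "cmod l * C < 1 / 2"
        using mult_right_mono[OF \<open>cmod l \<le> 1 / (4 * C)\<close>, of C] C(1) by simp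
      then have "\<exists>x. x \<noteq> 0 \<and> cblinfun_apply T x = l *\<^sub>C x"
        using v \<open>v \<notin> {0}\<close> C(1) g zI
        by (intro eigenvector_if_bounded_backward_orbit[of T z C]) (auto simp: z_def V_def null_space_on_def)
      ultimately show False using e(2) by blast
    qed
  qed
  have ex: "\<exists>a. null_space (T ^\<^sub>C a) = null_space (T ^\<^sub>C (a + 1))"
  proof (intro exI set_eqI iffI)
    fix x assume "x \<in> null_space (T ^\<^sub>C (n + k0))"
    then show "x \<in> null_space (T ^\<^sub>C (n + k0 + 1))" by (simp add: null_space_on_def cblinfun_compose.rep_eq T.zero)
  next
    fix x assume "x \<in> null_space (T ^\<^sub>C (n + k0 + 1))"
    then have "cblinfun_apply (T ^\<^sub>C (n + k0)) x \<in> V k0"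
      by (simp add: null_space_on_def cblinfun_compose.rep_eq V_def R_def range_on_def)
    then show "x \<in> null_space (T ^\<^sub>C (n + k0))" using V0 by (auto simp: null_space_on_def)
  qed
  define a where "a = (LEAST a. null_space (T ^\<^sub>C a) = null_space (T ^\<^sub>C (a + 1)))"
  have asc: "asc T = enat a" using ex by (simp add: asc_def a_def)
  have a: "null_space (T ^\<^sub>C a) = null_space (T ^\<^sub>C Suc a)"
    using LeastI_ex[OF ex] by (simp add: a_def)
  \<comment> \<open>Closedness is known only from exponent n on, and a + 1 may be smaller. Padding
    by n reaches that range of exponents, and the kernels no longer change beyond a.\<close>
  have "closed (op_range (T ^\<^sub>C (a + 1)))"
  proof (rule closed_op_range_power_if_null_space_eq[where i = n])
    show "closed (op_range (T ^\<^sub>C (a + 1 + n)))" using clR[of "a + 1"] by (simp add: R_def add.commute)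
    show "null_space (T ^\<^sub>C (a + 1 + n)) = null_space (T ^\<^sub>C (a + 1))"
      using null_space_powers_stable[OF a, of "a + 1 + n"] null_space_powers_stable[OF a, of "a + 1"] by simp
  qed
  with asc show ?thesis by blast
qed

section \<open>Seminorms on polynomials and commuting operators\<close>

lemma sum_root_of_unity_powers:
  assumes "0 < m" "m < n"
  shows "(\<Sum>k<n. (cis (2 * pi / real n) ^ k) ^ m) = 0"
proof -
  define \<omega> where "\<omega> = cis (2 * pi / real n)"
  have wm: "\<omega> ^ m = cis (2 * pi * real m / real n)"
    by (simp add: \<omega>_def Complex.DeMoivre field_simps)
  have inj: "inj_on (\<lambda>k. cis (2 * pi * real k / real n)) {..<n}"
    using Complex.bij_betw_roots_unity[of n] assms by (auto simp: bij_betw_def)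
  have ne: "\<omega> ^ m \<noteq> 1"
  proof
    assume "\<omega> ^ m = 1"
    then have "cis (2 * pi * real m / real n) = cis (2 * pi * real 0 / real n)"
      by (simp add: wm)
    from inj_onD[OF inj this] assms show False by auto
  qed
  have "\<omega> ^ n = 1"
    using assms by (simp add: \<omega>_def Complex.DeMoivre)
  then have "(\<omega> ^ m) ^ n - 1 = 0"
    by (simp flip: power_mult add: mult.commute[of m n]) (simp add: power_mult)
  moreover have "(\<omega> ^ m) ^ n - 1 = (\<omega> ^ m - 1) * (\<Sum>k<n. (\<omega> ^ m) ^ k)"
    by (rule power_diff_1_eq)
  ultimately have "(\<Sum>k<n. (\<omega> ^ m) ^ k) = 0"
    using ne by simp
  then show ?thesis
    by (simp flip: power_mult add: \<omega>_def mult.commute)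
qed

text \<open>\<open>Q w k\<close> is the cofactor of X - w \<omega>^k in X^n - w^n. The second
  identity is the partial fraction expansion of n w^n / (X^n - w^n) with cleared denominators. The
  third subtracts two such expansions, for u and v, and applies the resolvent identity termwise:
  this produces the small factor u - v on which the comparison of radii rests.\<close>

lemma poly_partial_fraction_roots_of_unity:
  fixes u v :: complex and n :: nat
  defines "X \<equiv> [:0, 1:]"
  defines "\<omega> \<equiv> cis (2 * pi / real n)"
  defines "Q \<equiv> \<lambda>w k. \<Sum>j<n. X ^ (n - Suc j) * [:w * \<omega> ^ k:] ^ j"
  assumes n: "0 < n"
  shows "[:- (w * \<omega> ^ k), 1:] * Q w k = X ^ n - [:w ^ n:]"
    and "(\<Sum>k<n. [:w * \<omega> ^ k:] * Q w k) = of_nat n * [:w ^ n:]"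
    and "of_nat n * X ^ n * [:u ^ n - v ^ n:] =
      [:u - v:] * X * (\<Sum>k<n. [:\<omega> ^ k:] * Q u k * Q v k)"
proof -
  have wn: "\<omega> ^ n = 1"
    using n by (simp add: \<omega>_def Complex.DeMoivre)
  have const_power: "[:c:] ^ j = [:c ^ j:]" for c :: complex and j
    by (induction j) (auto simp: one_pCons)
  obtain n' where n': "n = Suc n'" using n by (cases n) auto
  have lin: "[:- c, 1:] = X - [:c:]" for c :: complex
    by (simp add: X_def)
  show fac: "[:- (w * \<omega> ^ k), 1:] * Q w k = X ^ n - [:w ^ n:]" for w k
  proof -
    have "Q w k = (\<Sum>j<n. X ^ j * [:w * \<omega> ^ k:] ^ (n - Suc j))"
      unfolding Q_def by (rule sum.reindex_bij_witness[of _ "\<lambda>j. n - Suc j" "\<lambda>j. n - Suc j"]) auto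
    then have "[:- (w * \<omega> ^ k), 1:] * Q w k = X ^ n - [:w * \<omega> ^ k:] ^ n"
      unfolding n' lin using diff_power_eq_sum[of X n' "[:w * \<omega> ^ k:]"] by simp
    also have "(w * \<omega> ^ k) ^ n = w ^ n"
      using wn by (simp add: power_mult_distrib flip: power_mult)
        (simp add: power_mult mult.commute[of k n])
    then have "[:w * \<omega> ^ k:] ^ n = [:w ^ n:]"
      by (simp add: const_power)
    finally show ?thesis .
  qed
  show sumQ: "(\<Sum>k<n. [:w * \<omega> ^ k:] * Q w k) = of_nat n * [:w ^ n:]" for w
  proof -
    have "(\<Sum>k<n. [:w * \<omega> ^ k:] * Q w k) =
        (\<Sum>j<n. \<Sum>k<n. X ^ (n - Suc j) * [:(w * \<omega> ^ k) ^ Suc j:])"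
      unfolding Q_def sum_distrib_left
      by (subst sum.swap) (simp add: const_power algebra_simps)
    also have "\<dots> = (\<Sum>j<n. X ^ (n - Suc j) * [:w ^ Suc j * (\<Sum>k<n. (\<omega> ^ k) ^ Suc j):])"
    proof (rule sum.cong[OF refl])
      fix j
      have "(\<Sum>k<n. [:f k:]) = [:\<Sum>k<n. f k:]" for f :: "nat \<Rightarrow> complex"
        by (induction n) auto
      then show "(\<Sum>k<n. X ^ (n - Suc j) * [:(w * \<omega> ^ k) ^ Suc j:]) =
          X ^ (n - Suc j) * [:w ^ Suc j * (\<Sum>k<n. (\<omega> ^ k) ^ Suc j):]"
        by (simp only: sum_distrib_left[symmetric] power_mult_distrib)
    qed
    \<comment> \<open>The exponents Suc j run from 1 to n, and the sum over the roots of unity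
      vanishes for all of them except n.\<close>
    also have "\<dots> = (\<Sum>j<n. if j = n' then [:w ^ n * of_nat n:] else 0)"
    proof (rule sum.cong[OF refl])
      fix j assume j: "j \<in> {..<n}"
      show "X ^ (n - Suc j) * [:w ^ Suc j * (\<Sum>k<n. (\<omega> ^ k) ^ Suc j):] =
          (if j = n' then [:w ^ n * of_nat n:] else 0)"
      proof (cases "j = n'")
        case True
        have "(\<omega> ^ k) ^ n = 1" for k
          using wn by (metis mult.commute power_mult power_one)
        then show ?thesis using True n' by (simp del: power_Suc)
      next
        case False
        then have "(\<Sum>k<n. (\<omega> ^ k) ^ Suc j) = 0"
          unfolding \<omega>_def using j n' by (intro sum_root_of_unity_powers) auto
        then show ?thesis using False by (simp del: power_Suc)
      qed
    qed
    also have "\<dots> = of_nat n * [:w ^ n:]"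
      using n' by (simp add: of_nat_poly mult.commute del: of_nat_Suc)
    finally show ?thesis .
  qed
  have "of_nat n * X ^ n * [:u ^ n - v ^ n:] =
      (of_nat n * [:u ^ n:]) * (X ^ n - [:v ^ n:]) - (of_nat n * [:v ^ n:]) * (X ^ n - [:u ^ n:])"
  proof -
    have "[:u ^ n - v ^ n:] = [:u ^ n:] - [:v ^ n:]" by simp
    then show ?thesis by (simp only:) (simp only: algebra_simps)
  qed
  also have "\<dots> = (\<Sum>k<n. [:u * \<omega> ^ k:] * Q u k * (X ^ n - [:v ^ n:])
      - [:v * \<omega> ^ k:] * Q v k * (X ^ n - [:u ^ n:]))"
    by (simp only: sumQ[symmetric] sum_distrib_right sum_subtractf)
  also have "\<dots> = (\<Sum>k<n. [:u - v:] * X * ([:\<omega> ^ k:] * Q u k * Q v k))"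
  proof (rule sum.cong[OF refl])
    fix k
    define a where "a = [:\<omega> ^ k:]"
    have e: "[:u * \<omega> ^ k:] = [:u:] * a" "[:v * \<omega> ^ k:] = [:v:] * a" "[:u - v:] = [:u:] - [:v:]"
      by (simp_all add: a_def)
    show "[:u * \<omega> ^ k:] * Q u k * (X ^ n - [:v ^ n:])
        - [:v * \<omega> ^ k:] * Q v k * (X ^ n - [:u ^ n:]) =
        [:u - v:] * X * ([:\<omega> ^ k:] * Q u k * Q v k)"
      unfolding fac[symmetric, of _ k] lin a_def[symmetric] e
      by (simp only: algebra_simps)
  qed
  finally show "of_nat n * X ^ n * [:u ^ n - v ^ n:] =
      [:u - v:] * X * (\<Sum>k<n. [:\<omega> ^ k:] * Q u k * Q v k)"
    by (simp only: sum_distrib_left)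
qed

text \<open>This is a form of the non-emptiness of the spectrum: if every \<open>X - \<mu>\<close> is bounded below, then
  \<open>X\<close> acts on the zero space. The argument avoids Liouville's theorem and completions (Rickart). If
  \<open>X\<^sup>n\<close> is small compared with \<open>w\<^sup>n\<close> for large \<open>n\<close>, \<open>poly_partial_fraction_roots_of_unity\<close> shows the same for a radius
  smaller than \<open>w\<close> by a fixed amount, so that eventually the radius drops below the lower bound
  of \<open>X\<close> itself.\<close>

lemma poly_seminorm_vanishes:
  fixes q :: "complex poly \<Rightarrow> real" and C :: real
  defines "X \<equiv> [:0, 1:]"
  assumes add: "\<And>a b. q (a + b) \<le> q a + q b"
    and scale: "\<And>c a. q (smult c a) = cmod c * q a"
    and C: "0 < C" "\<And>a. q (X * a) \<le> C * q a"
    and low: "\<And>\<mu>. \<exists>\<delta>>0. \<forall>p. \<delta> * q p \<le> q ([:- \<mu>, 1:] * p)"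
  shows "q p = 0"
proof -
  have q0: "q 0 = 0" using scale[of 0 0] by simp
  have qneg: "q (- a) = q a" for a using scale[of "-1" a] by simp
  have qpos: "0 \<le> q a" for a
    using add[of a "- a"] by (simp add: q0 qneg)
  have qdiff: "q (a - b) \<le> q a + q b" for a b
    using add[of a "- b"] by (simp add: qneg)
  have qsum: "q (\<Sum>i\<in>I. f i) \<le> (\<Sum>i\<in>I. q (f i))" for I :: "nat set" and f
    by (induction I rule: infinite_finite_induct) (auto simp: q0 intro: order_trans[OF add])
  have qX: "q (X ^ n * a) \<le> C ^ n * q a" for n a
  proof (induction n)
    case (Suc n)
    have "q (X * (X ^ n * a)) \<le> C * (C ^ n * q a)"
      using C(2)[of "X ^ n * a"] Suc C(1) by (meson mult_left_mono less_imp_le order_trans)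
    then show ?case by (simp add: algebra_simps)
  qed simp
  define R where "R = C + 1"
  have R: "0 < R" "C < R" using C by (simp_all add: R_def)
  obtain d where d: "\<And>\<mu>. 0 < d \<mu>" "\<And>\<mu> p. d \<mu> * q p \<le> q ([:- \<mu>, 1:] * p)"
    using low by metis
  \<comment> \<open>One lower bound for the whole disc: compactness leaves finitely many centres,
    and moving from a centre \<nu> by less than d \<nu> / 2 costs at most half of its bound.\<close>
  obtain \<delta> where \<delta>: "0 < \<delta>"
    "\<And>\<mu> p. cmod \<mu> \<le> R \<Longrightarrow> \<delta> * q p \<le> q ([:- \<mu>, 1:] * p)"
  proof -
    have "cball 0 R \<subseteq> (\<Union>\<mu>\<in>cball 0 R. ball \<mu> (d \<mu> / 2))"
    proof
      fix x :: complex assume "x \<in> cball 0 R"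
      then show "x \<in> (\<Union>\<mu>\<in>cball 0 R. ball \<mu> (d \<mu> / 2))" 
        using d(1)[of x] by (intro UN_I[of x]) auto
    qed
    then obtain F where F: "F \<subseteq> cball 0 R" "finite F" "cball 0 R \<subseteq> (\<Union>\<mu>\<in>F. ball \<mu> (d \<mu> / 2))"
      using compactE_image[OF compact_cball[of "0 :: complex" R], of "cball 0 R" "\<lambda>\<mu>. ball \<mu> (d \<mu> / 2)"]
      by auto
    have "F \<noteq> {}" using F(3) R by auto
    define \<delta> where "\<delta> = Min ((\<lambda>\<mu>. d \<mu> / 2) ` F)"
    have "0 < \<delta>" using F \<open>F \<noteq> {}\<close> d(1) by (simp add: \<delta>_def)
    moreover have "\<delta> * q p \<le> q ([:- \<mu>, 1:] * p)" if "cmod \<mu> \<le> R" for \<mu> p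
    proof -
      from that F(3) obtain \<nu> where \<nu>: "\<nu> \<in> F" "dist \<nu> \<mu> < d \<nu> / 2" by auto
      have "\<delta> \<le> d \<nu> / 2" unfolding \<delta>_def using F \<nu> by (intro Min_le) auto
      have "[:- \<nu>, 1:] * p = [:- \<mu>, 1:] * p + smult (\<mu> - \<nu>) p"
        by (simp add: smult_diff_left)
      from arg_cong[OF this, of q] have "d \<nu> * q p \<le> q ([:- \<mu>, 1:] * p) + cmod (\<mu> - \<nu>) * q p"
        using d(2)[of \<nu> p] add[of "[:- \<mu>, 1:] * p" "smult (\<mu> - \<nu>) p"] unfolding scale by linarith
      moreover have "cmod (\<mu> - \<nu>) * q p \<le> d \<nu> / 2 * q p"
        using \<nu> qpos[of p] by (intro mult_right_mono) (auto simp: dist_norm norm_minus_commute)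
      moreover have "\<delta> * q p \<le> d \<nu> / 2 * q p"
        using \<open>\<delta> \<le> d \<nu> / 2\<close> qpos[of p] by (intro mult_right_mono)
      ultimately show ?thesis by (simp add: field_simps)
    qed
    ultimately show ?thesis using that by blast
  qed
  \<comment> \<open>A stand-in for the spectral radius of X being below w. The fixed factor 1/2,
    uniform in p, bounds multiplication by X^n - w^n by (3/2) w^n for large n.\<close>
  define S where "S w \<longleftrightarrow> (\<exists>N. \<forall>n\<ge>N. \<forall>p. q (X ^ n * p) \<le> w ^ n * q p / 2)" for w
  have small: "\<exists>N. \<forall>n\<ge>N. v ^ n \<le> w ^ n / 2" if vw: "0 < v" "v < w" for v w :: real
  proof -
    have "(\<lambda>n. (v / w) ^ n) \<longlonglongrightarrow> 0" using vw by (intro LIMSEQ_power_zero) auto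
    then have "\<forall>\<^sub>F n in sequentially. (v / w) ^ n < 1 / 2" by (rule order_tendstoD) simp
    then obtain N where "\<And>n. n \<ge> N \<Longrightarrow> (v / w) ^ n < 1 / 2" by (auto simp: eventually_sequentially)
    then have "v ^ n \<le> w ^ n / 2" if "n \<ge> N" for n
      using that vw less_imp_le[of "(v / w) ^ n" "1 / 2"] by (simp add: power_divide field_simps)
    then show ?thesis by blast
  qed
  have SR: "S R"
  proof -
    from small[OF C(1) R(2)] obtain N where N: "\<And>n. n \<ge> N \<Longrightarrow> C ^ n \<le> R ^ n / 2" by blast
    have "q (X ^ n * p) \<le> R ^ n * q p / 2" if "n \<ge> N" for n p
      using qX[of n p] mult_right_mono[OF N[OF that] qpos[of p]] by simp
    then show ?thesis unfolding S_def by blast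
  qed
  \<comment> \<open>With a = q (X^n p) and b = v^n q p, the identity for w and v, two applications
    of the lower bound \<delta> and v^n \<le> w^n / 2 give \<delta>^2 a / 2 \<le> (w - v) C (3/2) (a
    + b). The choice of 1/12 turns this into a / 2 \<le> (a + b) / 8, so 3 a \<le> b, which is more
    than the required a \<le> b / 2.\<close>
  have step: "S v" if vw: "0 < v" "v < w" "w \<le> R" and h: "(w - v) * C \<le> \<delta>\<^sup>2 / 12" and Sw: "S w" for v w
  proof -
    from small[OF vw(1,2)] obtain N1 where N1: "\<And>n. n \<ge> N1 \<Longrightarrow> v ^ n \<le> w ^ n / 2" by blast
    from Sw obtain N2 where N2: "\<And>n p. n \<ge> N2 \<Longrightarrow> q (X ^ n * p) \<le> w ^ n * q p / 2"
      unfolding S_def by blast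
    have "q (X ^ n * p) \<le> v ^ n * q p / 2" if n: "n \<ge> max 1 (max N1 N2)" for n p
    proof -
      define \<omega> where "\<omega> = cis (2 * pi / real n)"
      define Q where "Q = (\<lambda>w k. \<Sum>j<n. X ^ (n - Suc j) * [:complex_of_real w * \<omega> ^ k:] ^ j)"
      have n0: "0 < n" using n by simp
      have fac: "[:- (of_real w * \<omega> ^ k), 1:] * Q w k = X ^ n - [:of_real w ^ n:]" for w k
        using poly_partial_fraction_roots_of_unity(1)[OF n0, of "of_real w" k]
        by (simp only: Q_def \<omega>_def X_def)
      have w\<omega>: "cmod (of_real u * \<omega> ^ k) = \<bar>u\<bar>" for u k
        by (simp add: \<omega>_def norm_mult norm_power)
      have lowQ: "\<delta> * q (Q u k * r) \<le> q ((X ^ n - [:of_real u ^ n:]) * r)" if "0 < u" "u \<le> R" for u k r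
        using \<delta>(2)[of "of_real u * \<omega> ^ k" "Q u k * r"] that
        unfolding w\<omega> mult.assoc[symmetric] fac by simp
      define a where "a = q (X ^ n * p)"
      define b where "b = v ^ n * q p"
      define P where "P u = X ^ n - [:complex_of_real u ^ n:]" for u
      have qP: "q (P u * r) \<le> q (X ^ n * r) + u ^ n * q r" if "0 < u" for u r
        using qdiff[of "X ^ n * r" "smult (of_real u ^ n) r"] that
        by (simp add: P_def left_diff_distrib scale norm_power)
      have PP: "q (P w * (P v * p)) \<le> (3 / 2) * w ^ n * (a + b)"
      proof -
        have "q (P w * (P v * p)) \<le> (3 / 2) * w ^ n * q (P v * p)"
          using qP[of w "P v * p"] N2[of n "P v * p"] vw n by simp
        also have "\<dots> \<le> (3 / 2) * w ^ n * (a + b)"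
          using qP[of v p] vw by (intro mult_left_mono) (auto simp: a_def b_def)
        finally show ?thesis .
      qed
      \<comment> \<open>w \<omega>^k and v \<omega>^k lie in the disc of radius R, so each cofactor
        can be completed to X^n - w^n or X^n - v^n at the cost of one factor \<delta>.\<close>
      have QQ: "\<delta>\<^sup>2 * q (Q w k * (Q v k * p)) \<le> q (P w * (P v * p))" for k
      proof -
        have "\<delta> * (\<delta> * q (Q w k * (Q v k * p))) \<le> \<delta> * q (P w * (Q v k * p))"
          using lowQ[of w k "Q v k * p"] vw \<delta>(1) by (intro mult_left_mono) (auto simp: P_def)
        also have "\<dots> \<le> q (P w * (P v * p))"
          using lowQ[of v k "P w * p"] vw by (simp add: P_def ac_simps)
        finally show ?thesis by (simp add: power2_eq_square)
      qed
      have wv: "v ^ n \<le> w ^ n" using vw by (intro power_mono) auto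
      have "real n * (w ^ n - v ^ n) * a =
          q (of_nat n * X ^ n * [:of_real w ^ n - of_real v ^ n:] * p)"
      proof -
        have "of_nat n * X ^ n * [:of_real w ^ n - of_real v ^ n:] * p =
            smult (of_real (real n * (w ^ n - v ^ n))) (X ^ n * p)"
          by (simp add: of_nat_poly mult.commute)
        then show ?thesis
          using wv by (simp only: scale norm_of_real a_def) simp
      qed
      also have "of_nat n * X ^ n * [:of_real w ^ n - of_real v ^ n:] * p =
          smult (of_real (w - v)) (X * (\<Sum>k<n. smult (\<omega> ^ k) (Q w k * (Q v k * p))))"
      proof -
        have "of_nat n * X ^ n * [:of_real w ^ n - of_real v ^ n:] =
            [:of_real w - of_real v:] * X * (\<Sum>k<n. [:\<omega> ^ k:] * Q w k * Q v k)"
          using poly_partial_fraction_roots_of_unity(3)[OF n0, of "of_real w" "of_real v"]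
          by (simp only: Q_def \<omega>_def X_def)
        from arg_cong[OF this, of "\<lambda>x. x * p"] show ?thesis
          by (simp add: sum_distrib_right mult.assoc)
      qed
      also have "q \<dots> \<le> (w - v) * (C * (\<Sum>k<n. q (Q w k * (Q v k * p))))"
      proof -
        have "q (\<Sum>k<n. smult (\<omega> ^ k) (Q w k * (Q v k * p))) \<le> (\<Sum>k<n. q (Q w k * (Q v k * p)))"
          by (rule order_trans[OF qsum]) (simp add: scale \<omega>_def norm_power)
        then show ?thesis
          using vw C by (auto simp: scale simp flip: of_real_diff intro!: mult_left_mono
              intro: order_trans[OF C(2)])
      qed
      finally have main: "real n * (w ^ n - v ^ n) * a \<le> (w - v) * (C * (\<Sum>k<n. q (Q w k * (Q v k * p))))" .
      have "\<delta>\<^sup>2 * (\<Sum>k<n. q (Q w k * (Q v k * p))) \<le> real n * q (P w * (P v * p))"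
        unfolding sum_distrib_left using QQ
        by (intro order_trans[OF sum_bounded_above]) auto
      also have "\<dots> \<le> real n * ((3 / 2) * w ^ n * (a + b))"
        using PP by (intro mult_left_mono) auto
      finally have *: "\<delta>\<^sup>2 * (\<Sum>k<n. q (Q w k * (Q v k * p))) \<le> real n * ((3 / 2) * w ^ n * (a + b))" .
      have ab: "0 \<le> a" "0 \<le> b" using qpos vw by (auto simp: a_def b_def)
      have wn: "0 < w ^ n" using vw by simp
      have "\<delta>\<^sup>2 * (real n * (w ^ n / 2 * a)) \<le> \<delta>\<^sup>2 * (real n * (w ^ n - v ^ n) * a)"
      proof -
        have "w ^ n / 2 * a \<le> (w ^ n - v ^ n) * a"
          using N1[of n] n ab by (intro mult_right_mono) auto
        then show ?thesis unfolding mult.assoc by (intro mult_left_mono) auto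
      qed
      also have "\<dots> \<le> \<delta>\<^sup>2 * ((w - v) * (C * (\<Sum>k<n. q (Q w k * (Q v k * p)))))"
        using main by (intro mult_left_mono) auto
      also have "\<dots> = ((w - v) * C) * (\<delta>\<^sup>2 * (\<Sum>k<n. q (Q w k * (Q v k * p))))"
        by simp
      also have "\<dots> \<le> ((w - v) * C) * (real n * ((3 / 2) * w ^ n * (a + b)))"
        using * vw C by (intro mult_left_mono) auto
      also have "\<dots> \<le> \<delta>\<^sup>2 / 12 * (real n * ((3 / 2) * w ^ n * (a + b)))"
        using h ab wn by (intro mult_right_mono) auto
      finally have "(\<delta>\<^sup>2 * real n * w ^ n) * (a / 2) \<le> (\<delta>\<^sup>2 * real n * w ^ n) * ((a + b) / 8)"
        by (simp add: field_simps)
      then have "a / 2 \<le> (a + b) / 8"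
        using \<delta>(1) n0 wn by (subst (asm) mult_le_cancel_left_pos) auto
      then show ?thesis using ab by (simp add: a_def[symmetric] b_def[symmetric])
    qed
    then show ?thesis unfolding S_def by blast
  qed
  \<comment> \<open>The admissible decrease does not depend on the current radius, so finitely many
    steps lead from R to any positive radius.\<close>
  define h where "h = \<delta>\<^sup>2 / (12 * C)"
  have h: "0 < h" "h * C = \<delta>\<^sup>2 / 12" using \<delta>(1) C(1) by (simp_all add: h_def)
  have descend: "S w" if "0 < w" "w \<le> R" "R - real k * h \<le> w" for k w
    using that
  proof (induction k arbitrary: w)
    case 0
    then show ?case using SR by simp
  next
    case (Suc k)
    show ?case
    proof (cases "w = R")
      case False
      define w1 where "w1 = min (w + h) R"
      have w1: "w < w1" "w1 \<le> R" "w1 - w \<le> h" "R - real k * h \<le> w1"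
        using Suc.prems False h(1) by (auto simp: w1_def algebra_simps)
      have "S w1" using Suc.IH[of w1] w1 Suc.prems by simp
      moreover have "(w1 - w) * C \<le> \<delta>\<^sup>2 / 12"
        using w1(3) C(1) h(2) by (metis less_imp_le mult_right_mono)
      ultimately show ?thesis using step[of w w1] w1 Suc.prems by blast
    qed (use SR in simp)
  qed
  \<comment> \<open>At a radius at most \<delta> the bounds collide: \<delta>^n q p \<le> q (X^n p)
    \<le> w^n q p / 2 \<le> \<delta>^n q p / 2.\<close>
  define w where "w = min \<delta> R"
  have w: "0 < w" "w \<le> R" "w \<le> \<delta>" using \<delta>(1) R by (auto simp: w_def)
  obtain k :: nat where "R / h \<le> real k" using real_arch_simple by blast
  then have "R - real k * h \<le> w" using h(1) w(1) by (simp add: field_simps)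
  from descend[OF w(1,2) this] obtain n where n: "\<And>p. q (X ^ n * p) \<le> w ^ n * q p / 2"
    unfolding S_def by blast
  have lower: "\<delta> ^ m * q p \<le> q (X ^ m * p)" for m
  proof (induction m)
    case (Suc m)
    have "\<delta> * (\<delta> ^ m * q p) \<le> \<delta> * q (X ^ m * p)"
      using Suc \<delta>(1) by (intro mult_left_mono) auto
    also have "\<dots> \<le> q (X ^ Suc m * p)"
      using \<delta>(2)[of 0 "X ^ m * p"] R by (simp add: X_def mult.assoc)
    finally show ?case by (simp add: mult.assoc)
  qed simp
  have "\<delta> ^ n * q p \<le> w ^ n * q p / 2" using lower[of n] n[of p] by linarith
  also have "\<dots> \<le> \<delta> ^ n * q p / 2"
    using w qpos[of p] by (intro divide_right_mono mult_right_mono power_mono) auto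
  finally have "\<delta> ^ n * q p \<le> 0" by (simp add: mult.commute)
  then show ?thesis
    using zero_less_power[OF \<delta>(1), of n] qpos[of p] by (auto simp: mult_le_0_iff)
qed

section \<open>Polynomials in an operator, applied to a vector\<close>

definition poly_apply ::
    "complex poly \<Rightarrow> ('a :: complex_normed_vector \<Rightarrow>\<^sub>\<complex> 'a) \<Rightarrow> 'a \<Rightarrow> 'a"
  where "poly_apply p T x = (\<Sum>i\<le>degree p. coeff p i *\<^sub>C cblinfun_apply (T ^\<^sub>C i) x)"

lemma cblinfun_apply_diff_right:
  "cblinfun_apply T (x - y) = cblinfun_apply T x - cblinfun_apply T y"
  by (rule linear_diff[OF bounded_linear.linear[OF bounded_linear_cblinfun_apply]])

lemma cblinfun_apply_zero_right: "cblinfun_apply T 0 = 0"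
  by (rule linear_0[OF bounded_linear.linear[OF bounded_linear_cblinfun_apply]])

lemma poly_apply_eq_sum:
  "degree p \<le> n \<Longrightarrow> poly_apply p T x = (\<Sum>i\<le>n. coeff p i *\<^sub>C cblinfun_apply (T ^\<^sub>C i) x)"
  unfolding poly_apply_def by (rule sum.mono_neutral_left) (auto simp: coeff_eq_0)

lemma poly_apply_add: "poly_apply (p + q) T x = poly_apply p T x + poly_apply q T x"
  using poly_apply_eq_sum[of p "max (degree p) (degree q)" T x]
    poly_apply_eq_sum[of q "max (degree p) (degree q)" T x]
    poly_apply_eq_sum[OF degree_add_le_max[of p q], of T x]
  by (simp add: scaleC_add_left sum.distrib)

lemma poly_apply_smult: "poly_apply (smult c p) T x = c *\<^sub>C poly_apply p T x"
  by (simp add: poly_apply_eq_sum[OF degree_smult_le] poly_apply_def complex_vector.scale_sum_right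
      scaleC_scaleC)

lemma poly_apply_pCons_0: "poly_apply (pCons 0 p) T x = cblinfun_apply T (poly_apply p T x)"
proof -
  interpret T: bounded_linear "cblinfun_apply T" by (rule bounded_linear_cblinfun_apply)
  have "poly_apply (pCons 0 p) T x =
      (\<Sum>i\<le>Suc (degree p). coeff (pCons 0 p) i *\<^sub>C cblinfun_apply (T ^\<^sub>C i) x)"
    by (rule poly_apply_eq_sum) (rule degree_pCons_le)
  also have "\<dots> = (\<Sum>i\<le>degree p. coeff p i *\<^sub>C cblinfun_apply T (cblinfun_apply (T ^\<^sub>C i) x))"
    by (subst sum.atMost_Suc_shift) (simp add: cblinfun_compose.rep_eq)
  also have "\<dots> = cblinfun_apply T (poly_apply p T x)"
    by (simp add: poly_apply_def T.sum cblinfun_apply_scaleC)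
  finally show ?thesis .
qed

lemma poly_apply_linear_factor:
  "poly_apply ([:- c, 1:] * p) T x = cblinfun_apply T (poly_apply p T x) - c *\<^sub>C poly_apply p T x"
proof -
  have "[:- c, 1:] * p = pCons 0 p + smult (- c) p" by simp
  then show ?thesis
    by (simp only: poly_apply_add poly_apply_smult poly_apply_pCons_0) simp
qed

lemma poly_apply_commute:
  assumes "\<And>x. cblinfun_apply D (cblinfun_apply T x) = cblinfun_apply T (cblinfun_apply D x)"
  shows "cblinfun_apply D (poly_apply p T x) = poly_apply p T (cblinfun_apply D x)"
proof -
  interpret D: bounded_linear "cblinfun_apply D" by (rule bounded_linear_cblinfun_apply)
  have "cblinfun_apply D (cblinfun_apply (T ^\<^sub>C i) x) = cblinfun_apply (T ^\<^sub>C i) (cblinfun_apply D x)" for i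
    by (induction i) (simp_all add: cblinfun_id.rep_eq cblinfun_compose.rep_eq assms)
  then show ?thesis by (simp add: poly_apply_def D.sum cblinfun_apply_scaleC)
qed

lemma norm_poly_apply:
  "norm (poly_apply p T x) \<le> (\<Sum>i\<le>degree p. cmod (coeff p i) * norm (T ^\<^sub>C i)) * norm x"
  unfolding poly_apply_def sum_distrib_right
  by (rule sum_norm_le)
    (simp add: norm_scaleC mult.assoc mult_left_mono norm_cblinfun_apply)

text \<open>Applied to \<open>D = L - R - \<lambda>\<close> for commuting \<open>L\<close> and \<open>R\<close>. A sequence of unit vectors \<open>U n\<close> with
  \<open>D (U n) \<rightarrow> 0\<close> would make \<open>limsup \<parallel>p(L) (U n)\<parallel>\<close> a nonzero seminorm on polynomials that
  contradicts \<open>poly_seminorm_vanishes\<close>.\<close>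

lemma bounded_below_of_commuting:
  fixes L D :: "'a :: complex_normed_vector \<Rightarrow>\<^sub>\<complex> 'a"
  assumes comm: "\<And>x. cblinfun_apply D (cblinfun_apply L x) = cblinfun_apply L (cblinfun_apply D x)"
    and low: "\<And>\<mu>. \<exists>c>0. \<forall>x. c * norm x \<le> norm (cblinfun_apply L x - \<mu> *\<^sub>C x) + norm (cblinfun_apply D x)"
  shows "\<exists>c>0. \<forall>x. c * norm x \<le> norm (cblinfun_apply D x)"
proof (rule ccontr)
  interpret D: bounded_linear "cblinfun_apply D" by (rule bounded_linear_cblinfun_apply)
  assume neg: "\<not> (\<exists>c>0. \<forall>x. c * norm x \<le> norm (cblinfun_apply D x))"
  have "\<exists>x. norm x = 1 \<and> norm (cblinfun_apply D x) \<le> inverse (real (Suc n))" for n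
  proof -
    have "0 < inverse (real (Suc n))" by simp
    with neg obtain x where "\<not> inverse (real (Suc n)) * norm x \<le> norm (cblinfun_apply D x)" by blast
    then have x: "norm (cblinfun_apply D x) < inverse (real (Suc n)) * norm x" by simp
    then have "x \<noteq> 0" by auto
    then show ?thesis
      using x by (intro exI[of _ "inverse (norm x) *\<^sub>R x"]) (auto simp: D.scaleR field_simps)
  qed
  then obtain U where U: "\<And>n. norm (U n) = 1" "\<And>n. norm (cblinfun_apply D (U n)) \<le> inverse (real (Suc n))"
    by metis
  have DU: "(\<lambda>n. norm (cblinfun_apply D (U n))) \<longlonglongrightarrow> 0"
    by (rule tendsto_sandwich[OF _ _ tendsto_const LIMSEQ_inverse_real_of_nat])
      (auto simp: U simp del: of_nat_Suc)
  define K where "K p = (\<Sum>i\<le>degree p. cmod (coeff p i) * norm (L ^\<^sub>C i))" for p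
  \<comment> \<open>The eventual upper bounds of the sequence; their infimum q p is the limsup.
    \<open>K p\<close> bounds every term, so the set is nonempty.\<close>
  define S where "S p = {c. \<forall>\<^sub>F n in sequentially. norm (poly_apply p L (U n)) \<le> c}" for p
  define q where "q p = Inf (S p)" for p
  have K_S: "K p \<in> S p" for p
  proof -
    have "norm (poly_apply p L (U n)) \<le> K p" for n
      using norm_poly_apply[of p L "U n"] by (simp add: K_def U)
    then show ?thesis by (simp add: S_def)
  qed
  have S_pos: "0 \<le> c" if "c \<in> S p" for c p
  proof -
    from that have "\<forall>\<^sub>F n in sequentially. norm (poly_apply p L (U n)) \<le> c" by (simp add: S_def)
    then obtain n where "norm (poly_apply p L (U n)) \<le> c"
      using eventually_happens sequentially_bot by blast
    then show ?thesis by (rule order_trans[OF norm_ge_zero])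
  qed
  have q_le: "q p \<le> c" if "\<forall>\<^sub>F n in sequentially. norm (poly_apply p L (U n)) \<le> c" for p c
    unfolding q_def using that S_pos by (intro cInf_lower bdd_belowI[of _ 0]) (auto simp: S_def)
  have q_ev: "\<forall>\<^sub>F n in sequentially. norm (poly_apply p L (U n)) \<le> c" if "q p < c" for p c
  proof -
    from that obtain d where "d \<in> S p" "d < c" unfolding q_def using K_S cInf_lessD by blast
    then show ?thesis unfolding S_def by (auto elim: eventually_mono)
  qed
  have q_pos: "0 \<le> q p" for p
    unfolding q_def using K_S S_pos by (intro cInf_greatest) auto
  have "q 1 = 0"
  \<comment> \<open>The added 1 keeps the constant positive when L = 0.\<close>
  proof (rule poly_seminorm_vanishes[where C = "norm L + 1"])
    show "q (a + b) \<le> q a + q b" for a b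
    proof (rule field_le_epsilon)
      fix e :: real assume e: "0 < e"
      have "\<forall>\<^sub>F n in sequentially. norm (poly_apply a L (U n)) \<le> q a + e / 2"
        "\<forall>\<^sub>F n in sequentially. norm (poly_apply b L (U n)) \<le> q b + e / 2"
        using e by (auto intro!: q_ev)
      then have "\<forall>\<^sub>F n in sequentially. norm (poly_apply (a + b) L (U n)) \<le> q a + q b + e"
      proof eventually_elim
        case (elim n)
        then show ?case
          using norm_triangle_ineq[of "poly_apply a L (U n)" "poly_apply b L (U n)"]
          by (simp add: poly_apply_add)
      qed
      then show "q (a + b) \<le> q a + q b + e" by (rule q_le)
    qed
  next
    have le: "q (smult c a) \<le> cmod c * q a" if "c \<noteq> 0" for c a
    proof -
      have "q (smult c a) / cmod c \<le> q a"
      proof (rule dense_ge)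
        fix d assume "q a < d"
        then have "\<forall>\<^sub>F n in sequentially. norm (poly_apply (smult c a) L (U n)) \<le> cmod c * d"
          by (rule eventually_mono[OF q_ev]) (simp add: poly_apply_smult norm_scaleC mult_left_mono)
        from q_le[OF this] that show "q (smult c a) / cmod c \<le> d"
          by (simp add: pos_divide_le_eq mult.commute)
      qed
      then show ?thesis using that by (simp add: pos_divide_le_eq mult.commute)
    qed
    show "q (smult c a) = cmod c * q a" for c a
    proof (cases "c = 0")
      case True
      have "q 0 \<le> 0" by (rule q_le) (simp add: poly_apply_def)
      then show ?thesis using q_pos[of 0] True by simp
    next
      case False
      have "q a \<le> cmod (inverse c) * q (smult c a)"
        using le[of "inverse c" "smult c a"] False by simp
      then have "cmod c * q a \<le> q (smult c a)"
        using False unfolding norm_inverse by (simp add: field_simps)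
      then show ?thesis using le[OF False, of a] by simp
    qed
  next
    show L: "0 < norm L + 1" by (simp add: add_nonneg_pos)
    show "q ([:0, 1:] * a) \<le> (norm L + 1) * q a" for a
    proof -
      have "q ([:0, 1:] * a) / (norm L + 1) \<le> q a"
      proof (rule dense_ge)
        fix d assume d: "q a < d"
        then have "0 < d" using q_pos[of a] by simp
        have "\<forall>\<^sub>F n in sequentially. norm (poly_apply ([:0, 1:] * a) L (U n)) \<le> (norm L + 1) * d"
        proof (rule eventually_mono[OF q_ev[OF d]])
          fix n assume n: "norm (poly_apply a L (U n)) \<le> d"
          have "norm (cblinfun_apply L (poly_apply a L (U n))) \<le> norm L * norm (poly_apply a L (U n))"
            by (rule norm_cblinfun_apply)
          also have "\<dots> \<le> (norm L + 1) * d" using n \<open>0 < d\<close> by (intro mult_mono) auto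
          finally show "norm (poly_apply ([:0, 1:] * a) L (U n)) \<le> (norm L + 1) * d"
            by (simp add: poly_apply_pCons_0)
        qed
        from q_le[OF this] L show "q ([:0, 1:] * a) / (norm L + 1) \<le> d"
          by (simp add: pos_divide_le_eq mult.commute)
      qed
      then show ?thesis using L by (simp add: pos_divide_le_eq mult.commute)
    qed
  next
    fix \<mu>
    from low obtain c where c: "0 < c"
      "\<And>x. c * norm x \<le> norm (cblinfun_apply L x - \<mu> *\<^sub>C x) + norm (cblinfun_apply D x)" by metis
    \<comment> \<open>D commutes with p(L), so D p(L) (U n) = p(L) D (U n) tends to 0: in the limit
      the second summand of \<open>low\<close> disappears and a lower bound for L - \<mu> alone
      remains.\<close>
    have "c * q p \<le> q ([:- \<mu>, 1:] * p)" for p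
    proof (rule field_le_epsilon)
      fix e :: real assume e: "0 < e"
      have "(\<lambda>n. K p * norm (cblinfun_apply D (U n))) \<longlonglongrightarrow> 0"
        by (rule tendsto_mult_right_zero[OF DU])
      then have "\<forall>\<^sub>F n in sequentially. K p * norm (cblinfun_apply D (U n)) < e / 2"
        using e by (intro order_tendstoD) auto
      moreover have "\<forall>\<^sub>F n in sequentially. norm (poly_apply ([:- \<mu>, 1:] * p) L (U n)) \<le> q ([:- \<mu>, 1:] * p) + e / 2"
        using e by (intro q_ev) auto
      ultimately have "\<forall>\<^sub>F n in sequentially. norm (poly_apply p L (U n)) \<le> (q ([:- \<mu>, 1:] * p) + e) / c"
      proof eventually_elim
        case (elim n)
        have "norm (cblinfun_apply D (poly_apply p L (U n))) \<le> K p * norm (cblinfun_apply D (U n))"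
          unfolding poly_apply_commute[OF comm] K_def by (rule norm_poly_apply)
        then have "c * norm (poly_apply p L (U n)) \<le> q ([:- \<mu>, 1:] * p) + e"
          using elim c(2)[of "poly_apply p L (U n)"] unfolding poly_apply_linear_factor by linarith
        then show ?case using c(1) by (simp add: pos_le_divide_eq mult.commute)
      qed
      from q_le[OF this] show "c * q p \<le> q ([:- \<mu>, 1:] * p) + e"
        using c(1) by (simp add: pos_le_divide_eq mult.commute)
    qed
    then show "\<exists>\<delta>>0. \<forall>p. \<delta> * q p \<le> q ([:- \<mu>, 1:] * p)" using c(1) by blast
  qed
  moreover have "1 \<le> q 1"
    unfolding q_def
  proof (rule cInf_greatest)
    show "S 1 \<noteq> {}" using K_S by blast
    fix c assume "c \<in> S 1"
    then have "\<forall>\<^sub>F n in sequentially. 1 \<le> c"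
      by (simp add: S_def poly_apply_def scaleC_one cblinfun_id.rep_eq U)
    then show "1 \<le> c" by simp
  qed
  ultimately show False by simp
qed

section \<open>The approximate point spectrum of a generalized derivation\<close>

lemma cblinfun_apply_shift_by: "cblinfun_apply (shift_by T \<mu>) x = cblinfun_apply T x - \<mu> *\<^sub>C x"
  by (simp add: cblinfun_apply_minus cblinfun_apply_scaleC_left cblinfun_id.rep_eq)

lemma not_in_sigma_a_iff:
  fixes T :: "'a :: cbanach \<Rightarrow>\<^sub>\<complex> 'a"
  shows "\<mu> \<notin> sigma_a T \<longleftrightarrow> (\<exists>c>0. \<forall>x. c * norm x \<le> norm (cblinfun_apply T x - \<mu> *\<^sub>C x))"
  by (simp add: sigma_a_def bounded_below_iff cblinfun_apply_shift_by)

lemma compact_sigma_a: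
  fixes T :: "'a :: cbanach \<Rightarrow>\<^sub>\<complex> 'a"
  shows "compact (sigma_a T)"
  unfolding compact_eq_bounded_closed
proof
  have "cmod \<mu> \<le> norm T" if "\<mu> \<in> sigma_a T" for \<mu>
  proof (rule ccontr)
    assume "\<not> cmod \<mu> \<le> norm T"
    then have "0 < cmod \<mu> - norm T" by simp
    moreover have "(cmod \<mu> - norm T) * norm x \<le> norm (cblinfun_apply T x - \<mu> *\<^sub>C x)" for x
      using norm_triangle_ineq2[of "\<mu> *\<^sub>C x" "cblinfun_apply T x"] norm_cblinfun_apply[of T x]
      by (simp add: norm_scaleC norm_minus_commute left_diff_distrib)
    ultimately show False using that not_in_sigma_a_iff by blast
  qed
  then show "bounded (sigma_a T)" by (auto simp: bounded_iff)
  have "open (- sigma_a T)"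
  proof (rule openI)
    fix \<mu> assume "\<mu> \<in> - sigma_a T"
    then obtain c where c: "0 < c" "\<And>x. c * norm x \<le> norm (cblinfun_apply T x - \<mu> *\<^sub>C x)"
      using not_in_sigma_a_iff by blast
    have "\<nu> \<notin> sigma_a T" if "dist \<mu> \<nu> < c / 2" for \<nu>
    proof -
      have "c / 2 * norm x \<le> norm (cblinfun_apply T x - \<nu> *\<^sub>C x)" for x
      proof -
        have "cblinfun_apply T x - \<mu> *\<^sub>C x = (cblinfun_apply T x - \<nu> *\<^sub>C x) + (\<nu> - \<mu>) *\<^sub>C x"
          by (simp add: complex_vector.scale_left_diff_distrib)
        then have "norm (cblinfun_apply T x - \<mu> *\<^sub>C x) \<le>
            norm (cblinfun_apply T x - \<nu> *\<^sub>C x) + norm ((\<nu> - \<mu>) *\<^sub>C x)"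
          by (simp only: norm_triangle_ineq)
        then have "c * norm x \<le> norm (cblinfun_apply T x - \<nu> *\<^sub>C x) + cmod (\<nu> - \<mu>) * norm x"
          using c(2)[of x] unfolding norm_scaleC by linarith
        moreover have "cmod (\<nu> - \<mu>) * norm x \<le> c / 2 * norm x"
          using that by (intro mult_right_mono) (auto simp: dist_norm norm_minus_commute)
        ultimately show ?thesis by (simp add: field_simps)
      qed
      then show ?thesis using c(1) not_in_sigma_a_iff half_gt_zero by blast
    qed
    then show "\<exists>e>0. ball \<mu> e \<subseteq> - sigma_a T"
      using c(1) by (intro exI[of _ "c / 2"]) auto
  qed
  then show "closed (sigma_a T)" by (simp add: closed_def)
qed

section \<open>Lower bounds for left and right multiplication\<close>

lemma norm_compose_left_ge:
  assumes c: "0 < c" "\<And>x. c * norm x \<le> norm (cblinfun_apply A x - \<mu> *\<^sub>C x)"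
  shows "c * norm U \<le> norm (A o\<^sub>C U - \<mu> *\<^sub>C U)"
proof -
  have "norm U \<le> norm (A o\<^sub>C U - \<mu> *\<^sub>C U) / c"
  proof (rule norm_cblinfun_bound)
    fix y
    have "c * norm (cblinfun_apply U y) \<le> norm (cblinfun_apply (A o\<^sub>C U - \<mu> *\<^sub>C U) y)"
      using c(2)[of "cblinfun_apply U y"]
      by (simp add: cblinfun_apply_minus cblinfun_apply_scaleC_left cblinfun_compose.rep_eq)
    also have "\<dots> \<le> norm (A o\<^sub>C U - \<mu> *\<^sub>C U) * norm y" by (rule norm_cblinfun_apply)
    finally show "norm (cblinfun_apply U y) \<le> norm (A o\<^sub>C U - \<mu> *\<^sub>C U) / c * norm y"
      using c(1) by (simp add: field_simps)
  qed (use c in simp)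
  then show ?thesis using c(1) by (simp add: field_simps)
qed

text \<open>Composing with a functional f turns right multiplication by B on U into the adjoint of B
  acting on f o U, where the assumed bound applies. Choosing f to norm U y recovers the norm of U.
  This is why the spectrum of the adjoint, rather than that of B, governs the derivation.\<close>

lemma norm_compose_right_ge:
  fixes B :: "'y :: complex_normed_vector \<Rightarrow>\<^sub>\<complex> 'y" and U :: "'y \<Rightarrow>\<^sub>\<complex> 'x :: complex_normed_vector"
  assumes c: "0 < c" "\<And>\<phi>. c * norm \<phi> \<le> norm (cblinfun_apply (cblinfun_adjoint B) \<phi> - \<mu> *\<^sub>C \<phi>)"
  shows "c * norm U \<le> norm (U o\<^sub>C B - \<mu> *\<^sub>C U)"
proof -
  have "norm U \<le> norm (U o\<^sub>C B - \<mu> *\<^sub>C U) / c"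
  proof (rule norm_cblinfun_bound)
    fix y
    obtain f :: "'x \<Rightarrow>\<^sub>\<complex> complex" where f: "norm f \<le> 1"
      "norm (cblinfun_apply U y) \<le> cmod (cblinfun_apply f (cblinfun_apply U y))"
      by (rule Hahn_Banach_norming)
    have "(f o\<^sub>C U) o\<^sub>C B - \<mu> *\<^sub>C (f o\<^sub>C U) = f o\<^sub>C (U o\<^sub>C B - \<mu> *\<^sub>C U)"
      by (rule cblinfun_eqI)
        (simp add: cblinfun_apply_minus cblinfun_apply_scaleC_left cblinfun_compose.rep_eq
          cblinfun_apply_scaleC cblinfun_apply_diff_right)
    then have "c * norm (f o\<^sub>C U) \<le> norm (f o\<^sub>C (U o\<^sub>C B - \<mu> *\<^sub>C U))"
      using c(2)[of "f o\<^sub>C U"] by (simp add: cblinfun_adjoint_apply)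
    also have "\<dots> \<le> 1 * norm (U o\<^sub>C B - \<mu> *\<^sub>C U)"
      by (rule order_trans[OF norm_cblinfun_compose mult_right_mono]) (use f in auto)
    finally have "norm (f o\<^sub>C U) \<le> norm (U o\<^sub>C B - \<mu> *\<^sub>C U) / c" using c(1) by (simp add: field_simps)
    then have "norm (f o\<^sub>C U) * norm y \<le> norm (U o\<^sub>C B - \<mu> *\<^sub>C U) / c * norm y"
      by (rule mult_right_mono) simp
    moreover have "norm (cblinfun_apply U y) \<le> norm (f o\<^sub>C U) * norm y"
      using f(2) norm_cblinfun_apply[of "f o\<^sub>C U" y] by (simp add: cblinfun_compose.rep_eq)
    ultimately show "norm (cblinfun_apply U y) \<le> norm (U o\<^sub>C B - \<mu> *\<^sub>C U) / c * norm y" by simp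
  qed (use c in simp)
  then show ?thesis using c(1) by (simp add: field_simps)
qed

section \<open>Rank one operators as eigenvectors of the derivation\<close>

definition rank_one ::
    "('y :: complex_normed_vector \<Rightarrow>\<^sub>\<complex> complex) \<Rightarrow> 'x :: complex_normed_vector \<Rightarrow> 'y \<Rightarrow>\<^sub>\<complex> 'x"
  where "rank_one f x = CBlinfun (\<lambda>y. cblinfun_apply f y *\<^sub>C x)"

lemma rank_one_apply: "cblinfun_apply (rank_one f x) y = cblinfun_apply f y *\<^sub>C x"
proof -
  interpret f: bounded_linear "cblinfun_apply f" by (rule bounded_linear_cblinfun_apply)
  have f_scaleC: "cblinfun_apply f (c *\<^sub>C y) = c * cblinfun_apply f y" for c y
    by (simp add: cblinfun_apply_scaleC scaleC_complex_def)
  have "bounded_clinear (\<lambda>y. cblinfun_apply f y *\<^sub>C x)"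
    unfolding bounded_clinear_def
  proof (intro conjI allI bounded_linear_intro[where K = "norm f * norm x"])
    show "norm (cblinfun_apply f y *\<^sub>C x) \<le> norm y * (norm f * norm x)" for y
      using mult_right_mono[OF norm_cblinfun_apply[of f y] norm_ge_zero[of x]]
      by (simp add: norm_scaleC algebra_simps)
  qed (simp_all add: f.add scaleC_add_left scaleR_scaleC scaleC_scaleC f_scaleC)
  then show ?thesis by (simp add: rank_one_def cblinfun_apply_CBlinfun)
qed

lemma norm_rank_one: "norm (rank_one f x) = norm f * norm x"
proof (rule antisym)
  show "norm (rank_one f x) \<le> norm f * norm x"
  proof (rule norm_cblinfun_bound)
    show "norm (cblinfun_apply (rank_one f x) y) \<le> norm f * norm x * norm y" for y
      using mult_right_mono[OF norm_cblinfun_apply[of f y] norm_ge_zero[of x]]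
      by (simp add: rank_one_apply norm_scaleC algebra_simps)
  qed simp
  show "norm f * norm x \<le> norm (rank_one f x)"
  proof (cases "x = 0")
    case False
    have "norm f \<le> norm (rank_one f x) / norm x"
    proof (rule norm_cblinfun_bound)
      show "norm (cblinfun_apply f y) \<le> norm (rank_one f x) / norm x * norm y" for y
        using norm_cblinfun_apply[of "rank_one f x" y] False
        by (simp add: rank_one_apply norm_scaleC field_simps)
    qed simp
    then show ?thesis using False by (simp add: field_simps)
  qed simp
qed

text \<open>The derivation acts on f \<otimes> x by a Leibniz rule, so the error at s - t splits
  into the error of x as an eigenvector of A for s and that of f as an eigenvector of the adjoint of
  B for t.\<close>

lemma generalized_derivation_rank_one:
  "cblinfun_apply (generalized_derivation A B) (rank_one f x) - (s - t) *\<^sub>C rank_one f x =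
    rank_one f (cblinfun_apply A x - s *\<^sub>C x) -
    rank_one (cblinfun_apply (cblinfun_adjoint B) f - t *\<^sub>C f) x"
  by (rule cblinfun_eqI)
    (simp add: generalized_derivation_apply cblinfun_adjoint_apply cblinfun_apply_minus
      cblinfun_apply_scaleC_left cblinfun_compose.rep_eq rank_one_apply cblinfun_apply_scaleC
      complex_vector.scale_right_diff_distrib complex_vector.scale_left_diff_distrib
      scaleC_scaleC scaleC_complex_def mult.commute[of s])

text \<open>Rank one operators built from approximate eigenvectors give one inclusion. For the
  other, if \<mu> is no difference, then for each s either A - s or the adjoint of B minus s - \<mu>
  is bounded below; each case yields the joint lower bound that
  \<open>bounded_below_of_commuting\<close> asks for.\<close>

lemma sigma_a_generalized_derivation:
  fixes A :: "'x :: cbanach \<Rightarrow>\<^sub>\<complex> 'x" and B :: "'y :: cbanach \<Rightarrow>\<^sub>\<complex> 'y"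
  shows "sigma_a (generalized_derivation A B) = difference_set (sigma_a A) (sigma_a (cblinfun_adjoint B))"
proof (intro equalityI subsetI)
  fix \<mu> assume "\<mu> \<in> difference_set (sigma_a A) (sigma_a (cblinfun_adjoint B))"
  then obtain s t where st: "\<mu> = s - t" "s \<in> sigma_a A" "t \<in> sigma_a (cblinfun_adjoint B)"
    by (auto simp: difference_set_def)
  show "\<mu> \<in> sigma_a (generalized_derivation A B)"
  proof (rule ccontr)
    assume "\<mu> \<notin> sigma_a (generalized_derivation A B)"
    then obtain c where c: "0 < c"
      "\<And>U. c * norm U \<le> norm (cblinfun_apply (generalized_derivation A B) U - \<mu> *\<^sub>C U)"
      using not_in_sigma_a_iff by blast
    \<comment> \<open>The factor x and the factor f each contribute an error, and each may use up
      half of the lower bound c.\<close>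
    have "0 < c / 2" using c(1) by simp
    then obtain x f where x: "norm (cblinfun_apply A x - s *\<^sub>C x) < c / 2 * norm x"
      and f: "norm (cblinfun_apply (cblinfun_adjoint B) f - t *\<^sub>C f) < c / 2 * norm f"
      using st(2,3) not_in_sigma_a_iff by (metis not_le)
    have pos: "0 < norm x" "0 < norm f" using x f by auto
    have "c * (norm f * norm x) \<le> norm (rank_one f (cblinfun_apply A x - s *\<^sub>C x) -
        rank_one (cblinfun_apply (cblinfun_adjoint B) f - t *\<^sub>C f) x)"
      using c(2)[of "rank_one f x"] by (simp add: st(1) generalized_derivation_rank_one norm_rank_one)
    also have "\<dots> \<le> norm f * norm (cblinfun_apply A x - s *\<^sub>C x) +
        norm (cblinfun_apply (cblinfun_adjoint B) f - t *\<^sub>C f) * norm x"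
      by (rule order_trans[OF norm_triangle_ineq4]) (simp add: norm_rank_one)
    also have "\<dots> < norm f * (c / 2 * norm x) + (c / 2 * norm f) * norm x"
      using x f pos by (intro add_strict_mono mult_strict_left_mono mult_strict_right_mono) auto
    finally show False by (simp add: algebra_simps)
  qed
next
  let ?D = "generalized_derivation A B"
  fix \<mu> assume \<mu>: "\<mu> \<in> sigma_a ?D"
  show "\<mu> \<in> difference_set (sigma_a A) (sigma_a (cblinfun_adjoint B))"
  proof (rule ccontr)
    assume no: "\<mu> \<notin> difference_set (sigma_a A) (sigma_a (cblinfun_adjoint B))"
    \<comment> \<open>The derivation with B = 0 serves as the operator of left multiplication by
      A.\<close>
    have L: "cblinfun_apply (generalized_derivation A 0) U = A o\<^sub>C U" for U :: "'y \<Rightarrow>\<^sub>\<complex> 'x"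
    proof -
      have "U o\<^sub>C (0 :: 'y \<Rightarrow>\<^sub>\<complex> 'y) = 0"
        by (rule cblinfun_eqI) (simp add: cblinfun_compose.rep_eq zero_cblinfun.rep_eq
            cblinfun_apply_zero_right)
      then show ?thesis by (simp add: generalized_derivation_apply)
    qed
    have "\<exists>c>0. \<forall>U. c * norm U \<le> norm (cblinfun_apply (shift_by ?D \<mu>) U)"
    proof (rule bounded_below_of_commuting[where L = "generalized_derivation A 0"])
      show "cblinfun_apply (shift_by ?D \<mu>) (cblinfun_apply (generalized_derivation A 0) U) =
          cblinfun_apply (generalized_derivation A 0) (cblinfun_apply (shift_by ?D \<mu>) U)" for U
        unfolding L cblinfun_apply_shift_by unfolding generalized_derivation_apply
        by (rule cblinfun_eqI)
          (simp add: complex_vector.scale_right_diff_distrib cblinfun_apply_minus cblinfun_apply_scaleC_left cblinfun_compose.rep_eq cblinfun_apply_scaleC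
            cblinfun_apply_diff_right)
    next
      fix s
      have "s \<notin> sigma_a A \<or> s - \<mu> \<notin> sigma_a (cblinfun_adjoint B)"
      proof (rule ccontr)
        assume "\<not> ?thesis"
        moreover have "\<mu> = s - (s - \<mu>)" by simp
        ultimately show False using no unfolding difference_set_def by blast
      qed
      then show "\<exists>c>0. \<forall>U. c * norm U \<le> norm (cblinfun_apply (generalized_derivation A 0) U - s *\<^sub>C U) +
          norm (cblinfun_apply (shift_by ?D \<mu>) U)"
      proof
        assume "s \<notin> sigma_a A"
        then obtain c where c: "0 < c" "\<And>x. c * norm x \<le> norm (cblinfun_apply A x - s *\<^sub>C x)"
          using not_in_sigma_a_iff by blast
        have "c * norm U \<le> norm (A o\<^sub>C U - s *\<^sub>C U) + norm (cblinfun_apply (shift_by ?D \<mu>) U)" for U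
          using norm_compose_left_ge[OF c, of U] by (simp add: add_increasing2)
        then show ?thesis unfolding L using c(1) by blast
      next
        assume "s - \<mu> \<notin> sigma_a (cblinfun_adjoint B)"
        then obtain c where c: "0 < c"
          "\<And>\<phi>. c * norm \<phi> \<le> norm (cblinfun_apply (cblinfun_adjoint B) \<phi> - (s - \<mu>) *\<^sub>C \<phi>)"
          using not_in_sigma_a_iff by blast
        \<comment> \<open>Subtracting the shifted derivation from (A - s) U leaves U B - (s - \<mu>)
          U, so a lower bound for the latter bounds the sum of the two norms.\<close>
        have "c * norm U \<le> norm (A o\<^sub>C U - s *\<^sub>C U) + norm (cblinfun_apply (shift_by ?D \<mu>) U)" for U
        proof -
          have "U o\<^sub>C B - (s - \<mu>) *\<^sub>C U = (A o\<^sub>C U - s *\<^sub>C U) - cblinfun_apply (shift_by ?D \<mu>) U"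
            by (simp add: cblinfun_apply_shift_by generalized_derivation_apply
                complex_vector.scale_left_diff_distrib)
          then show ?thesis
            using norm_compose_right_ge[OF c, of U]
              norm_triangle_ineq4[of "A o\<^sub>C U - s *\<^sub>C U" "cblinfun_apply (shift_by ?D \<mu>) U"] by simp
        qed
        then show ?thesis unfolding L using c(1) by blast
      qed
    qed
    then show False using \<mu> unfolding sigma_a_def bounded_below_iff by blast
  qed
qed

section \<open>Limit points of difference sets\<close>

lemma eventually_eq_if_not_islimpt:
  fixes l :: "'a :: metric_space"
  assumes "f \<longlonglongrightarrow> l" "\<And>n. f n \<in> K" "\<not> l islimpt K"
  shows "\<forall>\<^sub>F n in sequentially. f n = l"
proof -
  from assms(3) obtain e where e: "0 < e" "\<And>x. x \<in> K \<Longrightarrow> dist x l < e \<Longrightarrow> x = l"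
    unfolding islimpt_approachable by blast
  from tendstoD[OF assms(1) e(1)] show ?thesis
    by (rule eventually_mono) (use e(2) assms(2) in blast)
qed

lemma islimpt_isometry:
  fixes x :: "'a :: metric_space" and f :: "'a \<Rightarrow> 'b :: metric_space"
  assumes x: "x islimpt N" and f: "f ` N \<subseteq> M" "\<And>y. dist (f y) (f x) = dist y x"
  shows "f x islimpt M"
  unfolding islimpt_approachable
proof (intro allI impI)
  fix e :: real assume "0 < e"
  with x obtain y where "y \<in> N" "y \<noteq> x" "dist y x < e" unfolding islimpt_approachable by blast
  then have "f y \<in> M" "dist (f y) (f x) < e" "dist (f y) (f x) \<noteq> 0" using f by auto
  then show "\<exists>y\<in>M. y \<noteq> f x \<and> dist y (f x) < e" by (intro bexI[of _ "f y"]) auto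
qed

text \<open>By compactness the two components of an approximating sequence converge along a common
  subsequence. If neither limit were a limit point, both components would eventually be constant,
  and the sequence would reach \<mu>, which it avoids. Conversely, a translate or a reflected
  translate of one set lies in the difference set.\<close>

lemma islimpt_difference_set:
  assumes K: "compact K" and L: "compact L"
  shows "\<mu> islimpt difference_set K L \<longleftrightarrow>
    (\<exists>s\<in>K. \<exists>t\<in>L. \<mu> = s - t \<and> (s islimpt K \<or> t islimpt L))"
proof
  assume "\<mu> islimpt difference_set K L"
  then obtain f where f: "\<And>n. f n \<in> difference_set K L - {\<mu>}" "f \<longlonglongrightarrow> \<mu>"
    unfolding islimpt_sequential by blast
  then have "f n \<in> difference_set K L" for n by blast
  then have "\<forall>n. \<exists>s t. s \<in> K \<and> t \<in> L \<and> f n = s - t" unfolding difference_set_def by blast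
  then obtain s t where st: "\<And>n. s n \<in> K" "\<And>n. t n \<in> L" "\<And>n. f n = s n - t n" by metis
  have "\<forall>n. (s n, t n) \<in> K \<times> L" using st by simp
  then obtain z r where z: "z \<in> K \<times> L" "strict_mono (r :: nat \<Rightarrow> nat)" "((\<lambda>n. (s n, t n)) \<circ> r) \<longlonglongrightarrow> z"
    by (rule seq_compactE[OF compact_imp_seq_compact[OF compact_Times[OF K L]]])
  have lim: "(\<lambda>n. s (r n)) \<longlonglongrightarrow> fst z" "(\<lambda>n. t (r n)) \<longlonglongrightarrow> snd z"
    using tendsto_fst[OF z(3)] tendsto_snd[OF z(3)] by (simp_all add: o_def)
  have "(\<lambda>n. f (r n)) \<longlonglongrightarrow> fst z - snd z" unfolding st(3) by (intro tendsto_diff lim)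
  moreover have "(\<lambda>n. f (r n)) \<longlonglongrightarrow> \<mu>" using LIMSEQ_subseq_LIMSEQ[OF f(2) z(2)] by (simp add: o_def)
  ultimately have \<mu>: "\<mu> = fst z - snd z" using LIMSEQ_unique by blast
  have "fst z islimpt K \<or> snd z islimpt L"
  proof (rule ccontr)
    assume "\<not> ?thesis"
    then have "\<forall>\<^sub>F n in sequentially. s (r n) = fst z" "\<forall>\<^sub>F n in sequentially. t (r n) = snd z"
      using eventually_eq_if_not_islimpt[OF lim(1) st(1)] eventually_eq_if_not_islimpt[OF lim(2) st(2)]
      by auto
    then have "\<forall>\<^sub>F n in sequentially. f (r n) = \<mu>" by eventually_elim (simp add: \<mu> st(3))
    then show False using f(1) by (auto simp: eventually_sequentially)
  qed
  then show "\<exists>s\<in>K. \<exists>t\<in>L. \<mu> = s - t \<and> (s islimpt K \<or> t islimpt L)"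
    using z(1) \<mu> by (cases z) auto
next
  assume "\<exists>s\<in>K. \<exists>t\<in>L. \<mu> = s - t \<and> (s islimpt K \<or> t islimpt L)"
  then obtain s t where st: "s \<in> K" "t \<in> L" "\<mu> = s - t" "s islimpt K \<or> t islimpt L" by blast
  from st(4) show "\<mu> islimpt difference_set K L"
  proof
    assume "s islimpt K"
    then have "(\<lambda>x. x - t) s islimpt difference_set K L"
      by (rule islimpt_isometry) (use st(2) in \<open>auto simp: difference_set_def dist_norm\<close>)
    then show ?thesis by (simp add: st(3))
  next
    assume "t islimpt L"
    then have "(\<lambda>x. s - x) t islimpt difference_set K L"
      by (rule islimpt_isometry) (use st(1) in \<open>auto simp: difference_set_def dist_norm norm_minus_commute\<close>)
    then show ?thesis by (simp add: st(3))
  qed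
qed

section \<open>Generalized a-Weyl and a-Browder theorems\<close>

text \<open>Replaces the dimension of a kernel by a single eigenvector, the form in which rank one
  operators can supply elements.\<close>

lemma E_a_iff:
  fixes T :: "'a :: complex_normed_vector \<Rightarrow>\<^sub>\<complex> 'a"
  shows "\<mu> \<in> E_a T \<longleftrightarrow> \<mu> \<in> isolated_points_of (sigma_a T) \<and> (\<exists>x. x \<noteq> 0 \<and> cblinfun_apply T x = \<mu> *\<^sub>C x)"
proof -
  let ?N = "null_space (shift_by T \<mu>)"
  have N: "complex_vector.subspace ?N"
    by (rule subspace_null_space_on[OF complex_vector.subspace_UNIV])
  have "edim ?N = 0 \<longleftrightarrow> ?N = {0}"
  proof
    assume e: "edim ?N = 0"
    then have fin: "fin_dim ?N" by (auto simp: edim_def split: if_splits)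
    then obtain S where S: "finite S" "complex_vector.span S = ?N" "card S = complex_vector.dim ?N"
      using fin_dim_basis[OF fin N] by metis
    then have "S = {}" using e fin by (simp add: edim_def zero_enat_def)
    then show "?N = {0}" using S by simp
  next
    assume "?N = {0}"
    moreover have "fin_dim {0 :: 'a}" by (auto simp: fin_dim_def intro!: exI[of _ "{}"])
    ultimately show "edim ?N = 0"
      using complex_vector.dim_eq_card_independent[OF complex_vector.independent_empty] complex_vector.dim_span[of "{} :: 'a set"]
      by (simp add: edim_def zero_enat_def)
  qed
  moreover have "?N = {0} \<longleftrightarrow> \<not> (\<exists>x. x \<noteq> 0 \<and> cblinfun_apply T x = \<mu> *\<^sub>C x)"
    by (auto simp: null_space_on_def cblinfun_apply_shift_by cblinfun_apply_zero_right)
  ultimately show ?thesis by (auto simp: E_a_def alpha_on_def zero_less_iff_neq_zero)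
qed

lemma sigma_SBF_eq_limit_points:
  assumes "a_isoloid T" "generalized_a_Weyl T"
  shows "sigma_SBF T = {\<mu> \<in> sigma_a T. \<mu> islimpt sigma_a T}"
  using assms by (auto simp: a_isoloid_def generalized_a_Weyl_def isolated_points_of_altdef)

text \<open>In every representation s - t of an isolated point, both s and t are isolated, since a
  limit point in either place would make s - t a limit point. Both are therefore eigenvalues, and
  the tensor of the eigenvectors is nonzero because its norm is the product of theirs.\<close>

lemma a_isoloid_generalized_derivation:
  fixes A :: "'x :: cbanach \<Rightarrow>\<^sub>\<complex> 'x" and B :: "'y :: cbanach \<Rightarrow>\<^sub>\<complex> 'y"
  assumes A: "a_isoloid A" and B: "a_isoloid (cblinfun_adjoint B)"
  shows "a_isoloid (generalized_derivation A B)"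
  unfolding a_isoloid_def
proof (intro equalityI subsetI)
  fix \<mu> assume \<mu>: "\<mu> \<in> isolated_points_of (sigma_a (generalized_derivation A B))"
  then obtain s t where st: "s \<in> sigma_a A" "t \<in> sigma_a (cblinfun_adjoint B)" "\<mu> = s - t"
    by (auto simp: isolated_points_of_altdef sigma_a_generalized_derivation difference_set_def)
  have "\<not> s islimpt sigma_a A" "\<not> t islimpt sigma_a (cblinfun_adjoint B)"
    using \<mu> st islimpt_difference_set[OF compact_sigma_a compact_sigma_a]
    unfolding isolated_points_of_altdef sigma_a_generalized_derivation by blast+
  then have "s \<in> E_a A" "t \<in> E_a (cblinfun_adjoint B)"
    using A B st by (auto simp: a_isoloid_def isolated_points_of_altdef)
  then obtain x f where x: "x \<noteq> 0" "cblinfun_apply A x = s *\<^sub>C x"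
    and f: "f \<noteq> 0" "cblinfun_apply (cblinfun_adjoint B) f = t *\<^sub>C f"
    unfolding E_a_iff by blast
  have zero: "norm (rank_one f 0 - rank_one 0 x) = 0"
    using norm_triangle_ineq4[of "rank_one f 0" "rank_one 0 x"] by (simp add: norm_rank_one)
  have "cblinfun_apply (generalized_derivation A B) (rank_one f x) - \<mu> *\<^sub>C rank_one f x = 0"
    using generalized_derivation_rank_one[of A B f x s t] zero by (simp add: st(3) x f)
  moreover have "rank_one f x \<noteq> 0"
    using norm_rank_one[of f x] x f by auto
  ultimately show "\<mu> \<in> E_a (generalized_derivation A B)"
    using \<mu> unfolding E_a_iff by (metis eq_iff_diff_eq_0)
qed (simp add: E_a_def)

text \<open>A punctured disc around an isolated point \<mu> avoids \<open>sigma_a T\<close>, so T -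
  (\<mu> + l) is injective for small nonzero l. Together with semi B-Fredholmness at \<mu> this
  yields the finite ascent and the closed range that \<open>Pi_a\<close> demands.\<close>

lemma Pi_a_eq_isolated_points:
  fixes T :: "'a :: cbanach \<Rightarrow>\<^sub>\<complex> 'a"
  assumes "isolated_points_of (sigma_a T) \<inter> sigma_SBF T = {}"
  shows "Pi_a T = isolated_points_of (sigma_a T)"
proof (intro equalityI subsetI)
  fix \<mu> assume \<mu>: "\<mu> \<in> isolated_points_of (sigma_a T)"
  then have "upper_semi_b_fredholm (shift_by T \<mu>)" using assms by (auto simp: sigma_SBF_def)
  moreover obtain e where e: "0 < e" "\<And>\<nu>. \<nu> \<in> sigma_a T \<Longrightarrow> dist \<nu> \<mu> < e \<Longrightarrow> \<nu> = \<mu>"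
    using \<mu> unfolding isolated_points_of_altdef islimpt_approachable by blast
  have "x = 0" if l: "0 < cmod l" "cmod l < e" and eig: "cblinfun_apply (shift_by T \<mu>) x = l *\<^sub>C x" for l x
  proof -
    have "\<mu> + l \<notin> sigma_a T" using e(2)[of "\<mu> + l"] l by (auto simp: dist_norm)
    then obtain c where c: "0 < c" "c * norm x \<le> norm (cblinfun_apply T x - (\<mu> + l) *\<^sub>C x)"
      using not_in_sigma_a_iff by blast
    have "cblinfun_apply T x - (\<mu> + l) *\<^sub>C x = 0"
      using eig by (simp add: cblinfun_apply_shift_by scaleC_add_left algebra_simps)
    then show "x = 0" using c by (simp add: mult_le_0_iff)
  qed
  ultimately have "\<exists>a. asc (shift_by T \<mu>) = enat a \<and> closed (op_range (shift_by T \<mu> ^\<^sub>C (a + 1)))"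
    using e(1) by (intro finite_ascent_if_injective_nearby) auto
  then show "\<mu> \<in> Pi_a T" using \<mu> by (simp add: Pi_a_def)
qed (simp add: Pi_a_def)

theorem theorem5p6:
  fixes A :: "'x :: cbanach \<Rightarrow>\<^sub>\<complex> 'x" and B :: "'y :: cbanach \<Rightarrow>\<^sub>\<complex> 'y"
  assumes "\<not> fin_dim (UNIV :: 'x set)" and "\<not> fin_dim (UNIV :: 'y set)"
    and "a_isoloid A" and "a_isoloid (cblinfun_adjoint B)"
    and "generalized_a_Weyl A" and "generalized_a_Weyl (cblinfun_adjoint B)"
  shows "generalized_a_Weyl (generalized_derivation A B) \<longleftrightarrow>
    generalized_a_Browder (generalized_derivation A B) \<and>
    sigma_SBF (generalized_derivation A B) =
      difference_set (sigma_a A) (sigma_SBF (cblinfun_adjoint B)) \<union>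
      difference_set (sigma_SBF A) (sigma_a (cblinfun_adjoint B))"
proof -
  let ?D = "generalized_derivation A B" and ?B = "cblinfun_adjoint B"
  let ?acc = "sigma_a ?D - isolated_points_of (sigma_a ?D)"
  \<comment> \<open>Neither side involves \<open>sigma_SBF ?D\<close>: the right-hand side of (ii)
    is computed from A and the adjoint of B alone, and the equation in (ii) can then be compared
    directly with the form \<open>W\<close> of (i).\<close>
  have acc: "difference_set (sigma_a A) (sigma_SBF ?B) \<union> difference_set (sigma_SBF A) (sigma_a ?B) = ?acc"
  proof (intro set_eqI)
    fix \<mu>
    have "\<mu> \<in> ?acc \<longleftrightarrow> \<mu> \<in> difference_set (sigma_a A) (sigma_a ?B) \<and>
        \<mu> islimpt difference_set (sigma_a A) (sigma_a ?B)"
      by (auto simp: sigma_a_generalized_derivation isolated_points_of_altdef)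
    also have "\<dots> \<longleftrightarrow> \<mu> \<in> difference_set (sigma_a A) (sigma_SBF ?B) \<union> difference_set (sigma_SBF A) (sigma_a ?B)"
      unfolding islimpt_difference_set[OF compact_sigma_a compact_sigma_a]
        sigma_SBF_eq_limit_points[OF assms(3,5)] sigma_SBF_eq_limit_points[OF assms(4,6)]
      unfolding difference_set_def by blast
    finally show "\<mu> \<in> difference_set (sigma_a A) (sigma_SBF ?B) \<union> difference_set (sigma_SBF A) (sigma_a ?B) \<longleftrightarrow>
        \<mu> \<in> ?acc" ..
  qed
  have "E_a ?D = isolated_points_of (sigma_a ?D)"
    using a_isoloid_generalized_derivation[OF assms(3,4)] by (simp add: a_isoloid_def)
  then have W: "generalized_a_Weyl ?D \<longleftrightarrow> sigma_SBF ?D = ?acc"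
    by (simp add: generalized_a_Weyl_def)
  moreover have "generalized_a_Browder ?D" if "sigma_SBF ?D = ?acc"
    using Pi_a_eq_isolated_points[of ?D] that by (auto simp: generalized_a_Browder_def)
  ultimately show ?thesis unfolding acc by blast
qed

end
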